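(* Let $A$ be an abelian group of finite exponent and set $d:=\sum_p d(U(p;A))$, the sum over all primes $p$. Then $A$ has breadth $d$, i.e., the lattice $\mathrm{PP}(A)$ of p.p.-definable subgroups of $A$ has breadth $d$.
   Context: $U(p,i;A):=|(p^iA)[p]/(p^{i+1}A)[p]|$ where $(p^iA)[p]=\{a\in p^iA:pa=0\}$, and $U(p;A):=\{i\ge0:U(p,i;A)\ne1\}$. For a finite nonempty set $I=\{i_1<\dots<i_n\}$ of integers, $d(I)$ is the maximal length $d$ of a sequence of indices $1=j(1)<j(2)<\dots<j(d)\le n$ such that for $k=1,\dots,d-1$: $j(k+1)-j(k)=1$ if $i_{j(k)+1}-i_{j(k)}>1$, and $j(k+1)-j(k)=2$ otherwise; $d(\emptyset):=0$. A positive-primitive (p.p.) formula is one of the form $\exists y\,(Cx=Dy)$ with integer matrices $C,D$; $\mathrm{PP}(A)$ is the set of subgroups of $A$ defined (without parameters) by p.p. formulas in one free variable, a lattice under $\cap$ and $+$. The breadth of a (meet-)semilattice $L$ is the smallest $d$ such that for all $x_1,\dots,x_n\in L$ with $n>d$ there are $i_1,\dots,i_d\in[n]$ with $x_1\wedge\dots\wedge x_n=x_{i_1}\wedge\dots\wedge x_{i_d}$. *)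

theory Defs
  imports
    "HOL-Algebra.Lattice"
    "HOL-Algebra.Multiplicative_Group"
    "HOL-Library.Extended_Nat"
    "HOL-Computational_Algebra.Primes"
    "Jordan_Normal_Form.Matrix"
begin

text \<open>Abelian groups are HOL-Algebra commutative groups, hence written multiplicatively:
  the multiple \<open>n a\<close> is \<open>a [^] n\<close>.\<close>

definition finite_exponent :: "('a, 'b) monoid_scheme \<Rightarrow> bool" where
  "finite_exponent A \<longleftrightarrow> (\<exists>m::nat. m > 0 \<and> (\<forall>a\<in>carrier A. a [^]\<^bsub>A\<^esub> m = \<one>\<^bsub>A\<^esub>))"

definition multiples :: "('a, 'b) monoid_scheme \<Rightarrow> nat \<Rightarrow> 'a set" where
  "multiples A n = (\<lambda>a. a [^]\<^bsub>A\<^esub> n) ` carrier A"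

definition torsion_in :: "('a, 'b) monoid_scheme \<Rightarrow> nat \<Rightarrow> 'a set \<Rightarrow> 'a set" where
  "torsion_in A p B = {a \<in> B. a [^]\<^bsub>A\<^esub> p = \<one>\<^bsub>A\<^esub>}"

definition ulm :: "nat \<Rightarrow> nat \<Rightarrow> ('a, 'b) monoid_scheme \<Rightarrow> enat" where
  "ulm p i A =
    (let Q = carrier (A\<lparr>carrier := torsion_in A p (multiples A (p ^ i))\<rparr>
                        Mod torsion_in A p (multiples A (p ^ (i + 1))))
     in if finite Q then enat (card Q) else \<infinity>)"

definition ulm_set :: "nat \<Rightarrow> ('a, 'b) monoid_scheme \<Rightarrow> nat set" where
  "ulm_set p A = {i. ulm p i A \<noteq> 1}"

definition nth_elem :: "int set \<Rightarrow> nat \<Rightarrow> int" where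
  "nth_elem I j = sorted_list_of_set I ! (j - 1)" \<comment> \<open>counting from \<open>j = 1\<close>\<close>

definition gap_sequence :: "int set \<Rightarrow> nat \<Rightarrow> (nat \<Rightarrow> nat) \<Rightarrow> bool" where
  "gap_sequence I d j \<longleftrightarrow>
     d \<ge> 1 \<and> j 1 = 1 \<and> strict_mono_on {1..d} j \<and> j d \<le> card I \<and>
     (\<forall>k\<in>{1..<d}. j (k + 1) - j k =
        (if nth_elem I (j k + 1) - nth_elem I (j k) > 1 then 1 else 2))"

definition gap_number :: "int set \<Rightarrow> nat" where
  "gap_number I = (if I = {} then 0 else Max {d. \<exists>j. gap_sequence I d j})"

definition mat_row_act ::
  "('a, 'b) monoid_scheme \<Rightarrow> int mat \<Rightarrow> (nat \<Rightarrow> 'a) \<Rightarrow> nat \<Rightarrow> 'a" where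
  "mat_row_act A M v i = (\<Otimes>\<^bsub>A\<^esub>j\<in>{..<dim_col M}. v j [^]\<^bsub>A\<^esub> (M $$ (i, j)))"

definition pp_holds ::
  "('a, 'b) monoid_scheme \<Rightarrow> int mat \<Rightarrow> int mat \<Rightarrow> (nat \<Rightarrow> 'a) \<Rightarrow> bool" where
  "pp_holds A C D x \<longleftrightarrow>
     (\<exists>y\<in>{..<dim_col D} \<rightarrow> carrier A. \<forall>i<dim_row C. mat_row_act A C x i = mat_row_act A D y i)"

definition PP :: "('a, 'b) monoid_scheme \<Rightarrow> 'a set set" where
  "PP A = {{a \<in> carrier A. pp_holds A C D (\<lambda>_. a)} | C D.
             dim_col C = 1 \<and> dim_row D = dim_row C}"

definition PP_lattice :: "('a, 'b) monoid_scheme \<Rightarrow> 'a set gorder" where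
  "PP_lattice A = \<lparr>carrier = PP A, eq = (=), le = (\<subseteq>)\<rparr>"

text \<open>For \<open>d = 0\<close> the meet on the right is the empty one, i.e. the greatest element of \<open>L\<close>.\<close>

definition breadth :: "('a, 'b) gorder_scheme \<Rightarrow> enat" where
  "breadth L = Inf {enat d | d. \<forall>n>d. \<forall>x\<in>{1..n} \<rightarrow> carrier L. \<exists>i\<in>{1..d} \<rightarrow> {1..n}.
     \<Sqinter>\<^bsub>L\<^esub>(x ` {1..n}) = \<Sqinter>\<^bsub>L\<^esub>((\<lambda>k. x (i k)) ` {1..d})}"

lemma (in comm_group) torsion_in_trivial:
  fixes m p i :: nat
  assumes m: "\<forall>a\<in>carrier G. a [^] m = \<one>" and dvd: "gcd (p ^ (i + 1)) m dvd p ^ i"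
  shows "torsion_in G p (multiples G (p ^ i)) = {\<one>}"
proof -
  have "a [^] (p ^ i) = \<one>" if a: "a \<in> carrier G" and t: "(a [^] (p ^ i)) [^] p = \<one>" for a
  proof -
    have "a [^] (p ^ (i + 1)) = \<one>" using t a by (simp add: nat_pow_pow mult.commute)
    then have "ord a dvd gcd (p ^ (i + 1)) m"
      using m a pow_eq_id[OF a] gcd_greatest by blast
    then have "ord a dvd p ^ i" using dvd dvd_trans by blast
    then show ?thesis using pow_eq_id[OF a] by blast
  qed
  moreover have "\<one> \<in> multiples G (p ^ i)"
    unfolding multiples_def by (metis imageI nat_pow_one one_closed)
  moreover have "b = \<one>" if "b \<in> torsion_in G p (multiples G (p ^ i))" for b
    using that calculation(1) unfolding torsion_in_def multiples_def by blast
  ultimately show ?thesis using nat_pow_one[of p] unfolding torsion_in_def by blast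
qed

lemma (in comm_group) ulm_eq_1:
  fixes m p i :: nat
  assumes m: "\<forall>a\<in>carrier G. a [^] m = \<one>"
    and dvd: "gcd (p ^ (i + 1)) m dvd p ^ i" "gcd (p ^ (i + 2)) m dvd p ^ (i + 1)"
  shows "ulm p i G = 1"
proof -
  have "torsion_in G p (multiples G (p ^ i)) = {\<one>}"
    using torsion_in_trivial[OF m dvd(1)] .
  moreover have "torsion_in G p (multiples G (p ^ (i + 1))) = {\<one>}"
    using torsion_in_trivial[OF m, of p "i + 1"] dvd(2) by simp
  ultimately show ?thesis
    by (simp add: ulm_def FactGroup_def RCOSETS_def r_coset_def one_enat_def)
qed

text \<open>The index set of a sum over all primes is infinite, and \<^const>\<open>sum\<close> vanishes on infinite
  index sets; the following lemma allows restricting it to the primes with a nonzero summand.\<close>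

lemma finite_ulm_support:
  assumes "comm_group A" and "finite_exponent A"
  shows "finite {p. prime p \<and> ulm_set p A \<noteq> {}}" and "prime p \<Longrightarrow> finite (ulm_set p A)"
proof -
  interpret comm_group A by fact
  obtain m :: nat where m: "m > 0" "\<forall>a\<in>carrier A. a [^]\<^bsub>A\<^esub> m = \<one>\<^bsub>A\<^esub>"
    using assms(2) unfolding finite_exponent_def by blast
  have "p dvd m" if p: "prime p" and ne: "ulm_set p A \<noteq> {}" for p
  proof (rule ccontr)
    assume "\<not> p dvd m"
    then have "coprime (p ^ k) m" for k
      using p by (simp add: prime_imp_coprime)
    then have "ulm p i A = 1" for i
      using ulm_eq_1[OF m(2), of p i] by (metis coprime_iff_gcd_eq_1 one_dvd)
    then show False using ne by (simp add: ulm_set_def)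
  qed
  then have "{p. prime p \<and> ulm_set p A \<noteq> {}} \<subseteq> {p. p dvd m}" by blast
  then show "finite {p. prime p \<and> ulm_set p A \<noteq> {}}"
    using finite_divisors_nat[OF m(1)] finite_subset by blast
  assume p: "prime p"
  have *: "gcd (p ^ (i + 1)) m dvd p ^ i" if "m \<le> i" for i
  proof -
    obtain k where k: "gcd (p ^ (i + 1)) m = p ^ k"
      using p by (metis divides_primepow_nat gcd_dvd1)
    have "k < p ^ k" using p by (intro power_gt_expt) (simp add: prime_gt_Suc_0_nat)
    also have "p ^ k \<le> m" using k m(1) by (metis dvd_imp_le gcd_dvd2)
    finally show ?thesis using k that by (simp add: le_imp_power_dvd)
  qed
  have "ulm p i A = 1" if "m \<le> i" for i
    using ulm_eq_1[OF m(2), of p i] *[of i] *[of "i + 1"] that by simp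
  then have "ulm_set p A \<subseteq> {..<m}"
    unfolding ulm_set_def using not_le by auto
  then show "finite (ulm_set p A)" using finite_subset by blast
qed

lemma (in comm_group) mat_row_act_closed:
  assumes "v \<in> {..<dim_col M} \<rightarrow> carrier G"
  shows "mat_row_act G M v i \<in> carrier G"
  unfolding mat_row_act_def using assms by (intro finprod_closed) (auto simp: Pi_iff)

lemma (in comm_group) mat_row_act_append:
  assumes v: "v \<in> {..<k + l} \<rightarrow> carrier G" and i: "i < m"
  shows "mat_row_act G (mat m (k + l) f) v i =
    mat_row_act G (mat m k f) v i \<otimes> mat_row_act G (mat m l (\<lambda>(i, j). f (i, k + j))) (\<lambda>j. v (k + j)) i"
proof -
  let ?g = "\<lambda>j. v j [^] f (i, j)"
  have g: "?g \<in> {..<k} \<rightarrow> carrier G" "?g \<in> (+) k ` {..<l} \<rightarrow> carrier G"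
    using v by (auto simp: Pi_iff)
  have u: "{..<k + l} = {..<k} \<union> (+) k ` {..<l}"
  proof -
    have "j \<in> (+) k ` {..<l}" if "j < k + l" "\<not> j < k" for j
      using that by (intro image_eqI[of _ _ "j - k"]) auto
    then show ?thesis by auto
  qed
  have "mat_row_act G (mat m (k + l) f) v i = finprod G ?g {..<k + l}"
    unfolding mat_row_act_def using v i by (intro finprod_cong') (auto simp: Pi_iff)
  also have "\<dots> = finprod G ?g {..<k} \<otimes> finprod G ?g ((+) k ` {..<l})"
    unfolding u using g by (intro finprod_Un_disjoint) auto
  also have "finprod G ?g ((+) k ` {..<l}) = finprod G (\<lambda>j. ?g (k + j)) {..<l}"
    using g(2) by (intro finprod_reindex) auto
  also have "\<dots> = mat_row_act G (mat m l (\<lambda>(i, j). f (i, k + j))) (\<lambda>j. v (k + j)) i"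
    unfolding mat_row_act_def using v i by (intro finprod_cong') (auto simp: Pi_iff)
  also have "finprod G ?g {..<k} = mat_row_act G (mat m k f) v i"
    unfolding mat_row_act_def using v i by (intro finprod_cong') (auto simp: Pi_iff)
  finally show ?thesis .
qed

lemma (in comm_group) mat_row_act_eq_rows:
  assumes "v \<in> {..<dim_col N} \<rightarrow> carrier G" "dim_col M = dim_col N"
    and "\<And>j. j < dim_col N \<Longrightarrow> M $$ (i, j) = N $$ (i', j) \<and> v j = w j"
  shows "mat_row_act G M v i = mat_row_act G N w i'"
  unfolding mat_row_act_def using assms by (intro finprod_cong') (auto simp: Pi_iff)

lemma (in comm_group) mat_row_act_zero_row:
  assumes "v \<in> {..<dim_col M} \<rightarrow> carrier G" "\<And>j. j < dim_col M \<Longrightarrow> M $$ (i, j) = 0"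
  shows "mat_row_act G M v i = \<one>"
  unfolding mat_row_act_def using assms by (intro finprod_one_eqI) (auto simp: Pi_iff)

lemma (in comm_group) PP_Int:
  assumes "X \<in> PP G" "Y \<in> PP G"
  shows "X \<inter> Y \<in> PP G"
proof -
  obtain C1 D1 C2 D2 where
    1: "X = {a \<in> carrier G. pp_holds G C1 D1 (\<lambda>_. a)}" "dim_col C1 = 1" "dim_row D1 = dim_row C1" and
    2: "Y = {a \<in> carrier G. pp_holds G C2 D2 (\<lambda>_. a)}" "dim_col C2 = 1" "dim_row D2 = dim_row C2"
    using assms unfolding PP_def by blast
  define m k l where "m = dim_row C1" and "k = dim_col D1" and "l = dim_col D2"
  define n where "n = m + dim_row C2"
  define C where "C = mat n 1 (\<lambda>(i, j). if i < m then C1 $$ (i, j) else C2 $$ (i - m, j))"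
  define f where "f = (\<lambda>(i, j). if i < m then if j < k then D1 $$ (i, j) else 0
                                else if j < k then 0 else D2 $$ (i - m, j - k))"
  define D where "D = mat n (k + l) f"
  have C: "mat_row_act G C (\<lambda>_. a) i =
      (if i < m then mat_row_act G C1 (\<lambda>_. a) i else mat_row_act G C2 (\<lambda>_. a) (i - m))"
    if "a \<in> carrier G" "i < n" for a i
    using that 1 2 by (auto simp: C_def intro!: mat_row_act_eq_rows)
  have D: "mat_row_act G D y i =
      (if i < m then mat_row_act G D1 y i else mat_row_act G D2 (\<lambda>j. y (k + j)) (i - m))"
    if y: "y \<in> {..<k + l} \<rightarrow> carrier G" and i: "i < n" for y i
  proof -
    have y': "y \<in> {..<k} \<rightarrow> carrier G" "(\<lambda>j. y (k + j)) \<in> {..<l} \<rightarrow> carrier G"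
      using y by (auto simp: Pi_iff)
    show ?thesis
    proof (cases "i < m")
      case True
      have "mat_row_act G (mat n k f) y i = mat_row_act G D1 y i"
        using True i y' by (intro mat_row_act_eq_rows) (auto simp: f_def k_def)
      moreover have "mat_row_act G (mat n l (\<lambda>(i, j). f (i, k + j))) (\<lambda>j. y (k + j)) i = \<one>"
        using True i y' by (intro mat_row_act_zero_row) (auto simp: f_def)
      moreover have "mat_row_act G D1 y i \<in> carrier G"
        using y' by (intro mat_row_act_closed) (simp add: k_def)
      ultimately show ?thesis
        using True mat_row_act_append[OF y i, of f] by (simp add: D_def)
    next
      case False
      have "mat_row_act G (mat n k f) y i = \<one>"
        using False i y' by (intro mat_row_act_zero_row) (auto simp: f_def)
      moreover have "mat_row_act G (mat n l (\<lambda>(i, j). f (i, k + j))) (\<lambda>j. y (k + j)) i =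
          mat_row_act G D2 (\<lambda>j. y (k + j)) (i - m)"
        using False i y' by (intro mat_row_act_eq_rows) (auto simp: f_def l_def)
      moreover have "mat_row_act G D2 (\<lambda>j. y (k + j)) (i - m) \<in> carrier G"
        using y' by (intro mat_row_act_closed) (simp add: l_def)
      ultimately show ?thesis
        using False mat_row_act_append[OF y i, of f] by (simp add: D_def)
    qed
  qed
  have "pp_holds G C D (\<lambda>_. a) \<longleftrightarrow> pp_holds G C1 D1 (\<lambda>_. a) \<and> pp_holds G C2 D2 (\<lambda>_. a)"
    if a: "a \<in> carrier G" for a
  proof
    assume "pp_holds G C D (\<lambda>_. a)"
    then obtain y where y: "y \<in> {..<k + l} \<rightarrow> carrier G"
      and eq: "\<And>i. i < n \<Longrightarrow> mat_row_act G C (\<lambda>_. a) i = mat_row_act G D y i"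
      unfolding pp_holds_def by (auto simp: C_def D_def)
    have "mat_row_act G C1 (\<lambda>_. a) i = mat_row_act G D1 y i" if "i < dim_row C1" for i
      using that eq[of i] C[OF a, of i] D[OF y, of i] by (simp add: n_def m_def)
    moreover have "mat_row_act G C2 (\<lambda>_. a) i = mat_row_act G D2 (\<lambda>j. y (k + j)) i"
      if "i < dim_row C2" for i
      using that eq[of "m + i"] C[OF a, of "m + i"] D[OF y, of "m + i"] by (simp add: n_def)
    ultimately show "pp_holds G C1 D1 (\<lambda>_. a) \<and> pp_holds G C2 D2 (\<lambda>_. a)"
      unfolding pp_holds_def using y
      by (intro conjI bexI[of _ y] bexI[of _ "\<lambda>j. y (k + j)"]) (auto simp: Pi_iff k_def l_def)
  next
    assume "pp_holds G C1 D1 (\<lambda>_. a) \<and> pp_holds G C2 D2 (\<lambda>_. a)"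
    then obtain y z where y: "y \<in> {..<k} \<rightarrow> carrier G" "z \<in> {..<l} \<rightarrow> carrier G"
      and eq: "\<And>i. i < m \<Longrightarrow> mat_row_act G C1 (\<lambda>_. a) i = mat_row_act G D1 y i"
        "\<And>i. i < dim_row C2 \<Longrightarrow> mat_row_act G C2 (\<lambda>_. a) i = mat_row_act G D2 z i"
      unfolding pp_holds_def m_def k_def l_def by blast
    define w where "w = (\<lambda>j. if j < k then y j else z (j - k))"
    have w: "w \<in> {..<k + l} \<rightarrow> carrier G"
      using y by (auto simp: w_def Pi_iff)
    have "mat_row_act G D1 w i = mat_row_act G D1 y i" for i
      using w by (intro mat_row_act_eq_rows) (auto simp: w_def k_def)
    moreover have "mat_row_act G D2 (\<lambda>j. w (k + j)) i = mat_row_act G D2 z i" for i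
      using y(2) by (intro mat_row_act_eq_rows) (auto simp: w_def l_def Pi_iff)
    ultimately have "mat_row_act G C (\<lambda>_. a) i = mat_row_act G D w i" if "i < n" for i
      using that eq(1)[of i] eq(2)[of "i - m"] C[OF a that] D[OF w that] by (simp add: n_def)
    then show "pp_holds G C D (\<lambda>_. a)"
      unfolding pp_holds_def using w by (intro bexI[of _ w]) (auto simp: C_def D_def)
  qed
  then have "X \<inter> Y = {a \<in> carrier G. pp_holds G C D (\<lambda>_. a)}"
    using 1(1) 2(1) by blast
  moreover have "dim_col C = 1" "dim_row D = dim_row C"
    by (simp_all add: C_def D_def)
  ultimately show ?thesis unfolding PP_def by blast
qed

lemma (in comm_group) carrier_in_PP: "carrier G \<in> PP G"
proof -
  have "carrier G = {a \<in> carrier G. pp_holds G (mat 0 1 (\<lambda>_. 0)) (mat 0 0 (\<lambda>_. 0)) (\<lambda>_. a)}"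
    by (auto simp: pp_holds_def)
  then show ?thesis unfolding PP_def
    by (intro CollectI exI[of _ "mat 0 1 (\<lambda>_. 0)"] exI[of _ "mat 0 0 (\<lambda>_. 0)"]) simp
qed

lemma (in comm_group) inf_PP_lattice:
  assumes "finite S" "S \<subseteq> PP G"
  shows "\<Sqinter>\<^bsub>PP_lattice G\<^esub>S = carrier G \<inter> \<Inter>S"
proof -
  have "carrier G \<inter> \<Inter>S \<in> PP G"
    using assms
  proof (induction S rule: finite_induct)
    case empty
    then show ?case by (simp add: carrier_in_PP)
  next
    case (insert x F)
    have "carrier G \<inter> \<Inter>(insert x F) = x \<inter> (carrier G \<inter> \<Inter>F)" by auto
    then show ?case using insert PP_Int by auto
  qed
  then have "greatest (PP_lattice G) (carrier G \<inter> \<Inter>S) (Lower (PP_lattice G) S)"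
    using assms(2) unfolding greatest_def Lower_def PP_lattice_def PP_def by auto
  moreover have "X = Y" if "greatest (PP_lattice G) X T" "greatest (PP_lattice G) Y T" for X Y T
    using that unfolding greatest_def PP_lattice_def by auto
  ultimately show ?thesis unfolding inf_def by (metis someI)
qed

end

theory Submission
  imports Defs
begin

text \<open>Diagonalising the matrix of a p.p. formula shows that p.p. subgroups are intersections of the
  groups \<open>{a. c a \<in> e A}\<close>, and by Bezout of the groups \<open>B(p,k,l) = {a. p^k a \<in> p^l A}\<close>. If
  \<open>i \<notin> U(p;A)\<close>, then \<open>B(p,k,i+1) = B(p,k,i) \<inter> B(p,k+1,i+2)\<close>, so the groups \<open>B(p,k,i+1)\<close> with
  \<open>k \<le> i \<in> U(p;A)\<close> already suffice. Since \<open>B(p,k,l) \<subseteq> B(p,k',l')\<close> as soon as \<open>k \<le> k'\<close> and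
  \<open>l - k \<ge> l' - k'\<close>, the indices \<open>i\<close> occurring in an antichain of such groups for one prime are
  pairwise at distance at least 2; the largest size of a subset of \<open>U(p;A)\<close> with that property is
  \<open>d(U(p;A))\<close>. This bounds the breadth from above. Conversely, for such subsets the groups
  \<open>B(p, i div 2, i+1)\<close> meet irredundantly.\<close>

section \<open>Systems of linear equations\<close>

definition int_multiples :: "('a, 'b) monoid_scheme \<Rightarrow> int \<Rightarrow> 'a set" where
  "int_multiples G e = (\<lambda>b. b [^]\<^bsub>G\<^esub> e) ` carrier G"

definition divisibility_set :: "('a, 'b) monoid_scheme \<Rightarrow> int \<Rightarrow> int \<Rightarrow> 'a set" where
  "divisibility_set G c e =
     {a \<in> carrier G. a [^]\<^bsub>G\<^esub> c \<in> int_multiples G e}"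

text \<open>The coefficients are functions on arbitrary index sets instead of matrices, so that
  deleting a row and a column just removes an element from \<open>R\<close> and one from
  \<open>J\<close>, without renumbering.\<close>

definition solvable_set ::
  "('a, 'b) monoid_scheme \<Rightarrow> 'i set \<Rightarrow> 'j set \<Rightarrow> ('i \<Rightarrow> int) \<Rightarrow> ('i \<Rightarrow> 'j \<Rightarrow> int) \<Rightarrow> 'a set" where
  "solvable_set G R J c D =
     {a \<in> carrier G. \<exists>y\<in>J \<rightarrow> carrier G. \<forall>i\<in>R. a [^]\<^bsub>G\<^esub> c i = (\<Otimes>\<^bsub>G\<^esub>j\<in>J. y j [^]\<^bsub>G\<^esub> D i j)}"

context comm_group
begin

lemma finprod_int_pow:
  fixes n :: int
  assumes "f \<in> J \<rightarrow> carrier G"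
  shows "(\<Otimes>j\<in>J. f j) [^] n = (\<Otimes>j\<in>J. f j [^] n)"
  using assms
proof (induction J rule: infinite_finite_induct)
  case (insert x F)
  then have "f \<in> F \<rightarrow> carrier G" "f x \<in> carrier G" "(\<lambda>j. f j [^] n) \<in> F \<rightarrow> carrier G"
    by (auto simp: Pi_iff)
  with insert show ?case by (simp add: int_pow_distrib)
qed auto

text \<open>One computation serves both elementary operations. For a row operation \<open>t\<close>
  is the multiplier and \<open>d'\<close> the pivot row; for a column operation \<open>t\<close> is
  an entry of the pivot column and \<open>d'\<close> the vector of multipliers.\<close>

lemma finprod_pow_add_mult:
  fixes d d' :: "'j \<Rightarrow> int"
  assumes "y \<in> J \<rightarrow> carrier G"
  shows "(\<Otimes>j\<in>J. y j [^] (d j + t * d' j)) =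
         (\<Otimes>j\<in>J. y j [^] d j) \<otimes> (\<Otimes>j\<in>J. y j [^] d' j) [^] t"
proof -
  have c: "(\<lambda>j. y j [^] d j) \<in> J \<rightarrow> carrier G" "(\<lambda>j. y j [^] d' j) \<in> J \<rightarrow> carrier G"
    "(\<lambda>j. (y j [^] d' j) [^] t) \<in> J \<rightarrow> carrier G"
    using assms by (auto simp: Pi_iff)
  have "(\<Otimes>j\<in>J. y j [^] (d j + t * d' j)) = (\<Otimes>j\<in>J. y j [^] d j \<otimes> (y j [^] d' j) [^] t)"
    using assms by (intro finprod_cong') (auto simp: Pi_iff int_pow_mult int_pow_pow mult.commute)
  also have "\<dots> = (\<Otimes>j\<in>J. y j [^] d j) \<otimes> (\<Otimes>j\<in>J. (y j [^] d' j) [^] t)"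
    using c by (intro finprod_multf)
  finally show ?thesis using finprod_int_pow[OF c(2)] by simp
qed

section \<open>Elementary row and column operations\<close>

lemma solvable_set_row_op_subset:
  assumes "i0 \<in> R"
  shows "solvable_set G R J c D \<subseteq>
    solvable_set G R J (\<lambda>i. c i + t i * c i0) (\<lambda>i j. D i j + t i * D i0 j)"
proof
  fix a assume "a \<in> solvable_set G R J c D"
  then obtain y where a: "a \<in> carrier G" and y: "y \<in> J \<rightarrow> carrier G"
    and eq: "\<And>i. i \<in> R \<Longrightarrow> a [^] c i = (\<Otimes>j\<in>J. y j [^] D i j)"
    by (auto simp: solvable_set_def)
  have "a [^] (c i + t i * c i0) = (\<Otimes>j\<in>J. y j [^] (D i j + t i * D i0 j))" if "i \<in> R" for i
  proof -
    have "a [^] (c i + t i * c i0) = a [^] c i \<otimes> (a [^] c i0) [^] t i"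
      using a by (simp add: int_pow_mult int_pow_pow mult.commute)
    then show ?thesis using eq that assms finprod_pow_add_mult[OF y] by simp
  qed
  then show "a \<in> solvable_set G R J (\<lambda>i. c i + t i * c i0) (\<lambda>i j. D i j + t i * D i0 j)"
    using a y by (auto simp: solvable_set_def)
qed

text \<open>Since \<open>t i0 = 0\<close>, row \<open>i0\<close> itself is unchanged, and the
  operation with \<open>- t\<close> undoes the one with \<open>t\<close>. So a single inclusion
  gives equality.\<close>

lemma solvable_set_row_op:
  assumes "i0 \<in> R" "t i0 = 0"
  shows "solvable_set G R J (\<lambda>i. c i + t i * c i0) (\<lambda>i j. D i j + t i * D i0 j) =
    solvable_set G R J c D"
  using solvable_set_row_op_subset[OF assms(1), of J c D t]
    solvable_set_row_op_subset[OF assms(1), of J "\<lambda>i. c i + t i * c i0"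
      "\<lambda>i j. D i j + t i * D i0 j" "\<lambda>i. - t i"] assms(2)
  by simp

text \<open>A column operation is a substitution: replacing the unknown \<open>y j0\<close> by
  \<open>y j0\<close> minus the sum of the \<open>t j\<close> multiples of the other
  \<open>y j\<close> cancels exactly the multiples of column \<open>j0\<close> that are
  added.\<close>

lemma solvable_set_col_op_subset:
  assumes "finite J" "j0 \<in> J" "t j0 = 0"
  shows "solvable_set G R J c D \<subseteq> solvable_set G R J c (\<lambda>i j. D i j + t j * D i j0)"
proof
  fix a assume "a \<in> solvable_set G R J c D"
  then obtain y where a: "a \<in> carrier G" and y: "y \<in> J \<rightarrow> carrier G"
    and eq: "\<And>i. i \<in> R \<Longrightarrow> a [^] c i = (\<Otimes>j\<in>J. y j [^] D i j)"
    by (auto simp: solvable_set_def)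
  define J' where "J' = J - {j0}"
  have J: "J = insert j0 J'" "finite J'" "j0 \<notin> J'"
    using assms by (auto simp: J'_def)
  define s where "s = (\<Otimes>j\<in>J'. y j [^] t j)"
  define z where "z = y(j0 := y j0 \<otimes> inv s)"
  have yc: "y j0 \<in> carrier G" "y \<in> J' \<rightarrow> carrier G" using y J by (auto simp: Pi_iff)
  have sc: "s \<in> carrier G" using yc unfolding s_def by (auto simp: Pi_iff)
  have zc: "z \<in> J \<rightarrow> carrier G" using y J sc by (auto simp: Pi_iff z_def)
  have "(\<Otimes>j\<in>J. z j [^] (D i j + t j * D i j0)) = (\<Otimes>j\<in>J. y j [^] D i j)" for i
  proof -
    let ?r = "\<Otimes>j\<in>J'. y j [^] D i j"
    have c: "(\<lambda>j. y j [^] D i j) \<in> J' \<rightarrow> carrier G" using yc by (auto simp: Pi_iff)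
    then have rc: "?r \<in> carrier G" by simp
    have zc': "(\<lambda>j. z j [^] (D i j + t j * D i j0)) \<in> J' \<rightarrow> carrier G"
      using zc J by (auto simp: Pi_iff)
    have "(\<Otimes>j\<in>J'. z j [^] (D i j + t j * D i j0)) = (\<Otimes>j\<in>J'. y j [^] (D i j + D i j0 * t j))"
      using yc J(3) by (intro finprod_cong') (auto simp: z_def Pi_iff mult.commute)
    also have "\<dots> = ?r \<otimes> s [^] D i j0"
      using finprod_pow_add_mult[OF yc(2)] by (simp add: s_def)
    finally have "(\<Otimes>j\<in>J. z j [^] (D i j + t j * D i j0)) =
        (y j0 \<otimes> inv s) [^] D i j0 \<otimes> (?r \<otimes> s [^] D i j0)"
      using J zc' zc assms(3) yc sc by (simp add: z_def Pi_iff)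
    also have "\<dots> = y j0 [^] D i j0 \<otimes> ?r \<otimes> (inv (s [^] D i j0) \<otimes> s [^] D i j0)"
      using yc sc rc int_pow_closed[OF sc] int_pow_closed[OF yc(1)]
      by (simp only: int_pow_distrib int_pow_inv m_ac inv_closed m_closed)
    also have "\<dots> = y j0 [^] D i j0 \<otimes> ?r"
      using yc sc rc by simp
    also have "\<dots> = (\<Otimes>j\<in>J. y j [^] D i j)"
      using J c yc by simp
    finally show ?thesis .
  qed
  then show "a \<in> solvable_set G R J c (\<lambda>i j. D i j + t j * D i j0)"
    using a zc eq by (auto simp: solvable_set_def intro!: bexI[of _ z])
qed

lemma solvable_set_col_op:
  assumes "finite J" "j0 \<in> J" "t j0 = 0"
  shows "solvable_set G R J c (\<lambda>i j. D i j + t j * D i j0) = solvable_set G R J c D"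
  using solvable_set_col_op_subset[of J j0 t R c D]
    solvable_set_col_op_subset[of J j0 "\<lambda>j. - t j" R c
      "\<lambda>i j. D i j + t j * D i j0"] assms
  by simp

text \<open>Row \<open>i0\<close> mentions only the unknown \<open>y j0\<close>, and
  \<open>y j0\<close> occurs in no other row. Hence a solution for row \<open>i0\<close> and a
  solution of the remaining rows can be chosen independently and put together.\<close>

lemma solvable_set_pivot:
  assumes J: "finite J" "j0 \<in> J" and i0: "i0 \<in> R"
    and row: "\<And>j. j \<in> J \<Longrightarrow> j \<noteq> j0 \<Longrightarrow> D i0 j = 0"
    and col: "\<And>i. i \<in> R \<Longrightarrow> i \<noteq> i0 \<Longrightarrow> D i j0 = 0"
  shows "solvable_set G R J c D =
    divisibility_set G (c i0) (D i0 j0) \<inter> solvable_set G (R - {i0}) (J - {j0}) c D"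
proof -
  define J' where "J' = J - {j0}"
  have J': "J = insert j0 J'" "finite J'" "j0 \<notin> J'"
    using J by (auto simp: J'_def)
  have i0_eq: "(\<Otimes>j\<in>J. y j [^] D i0 j) = y j0 [^] D i0 j0" if "y \<in> J \<rightarrow> carrier G" for y
  proof -
    have "(\<Otimes>j\<in>J'. y j [^] D i0 j) = \<one>"
      using row J' by (intro finprod_one_eqI) (auto, metis int_pow_0)
    then show ?thesis using that J' by (simp add: Pi_iff)
  qed
  have i_eq: "(\<Otimes>j\<in>J. y j [^] D i j) = (\<Otimes>j\<in>J'. y j [^] D i j)"
    if "y \<in> J \<rightarrow> carrier G" "i \<in> R" "i \<noteq> i0" for y i
    using that J' col[OF that(2,3)] by (simp add: Pi_iff)
  have "solvable_set G R J c D \<subseteq>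
      divisibility_set G (c i0) (D i0 j0) \<inter> solvable_set G (R - {i0}) J' c D"
  proof
    fix a assume "a \<in> solvable_set G R J c D"
    then obtain y where a: "a \<in> carrier G" and y: "y \<in> J \<rightarrow> carrier G"
      and eq: "\<And>i. i \<in> R \<Longrightarrow> a [^] c i = (\<Otimes>j\<in>J. y j [^] D i j)"
      by (auto simp: solvable_set_def)
    have "a \<in> divisibility_set G (c i0) (D i0 j0)"
      using a y J eq[OF i0] i0_eq[OF y] by (auto simp: divisibility_set_def int_multiples_def)
    moreover have "a \<in> solvable_set G (R - {i0}) J' c D"
      using a y eq i_eq[OF y] J' by (auto simp: solvable_set_def intro!: bexI[of _ y])
    ultimately show "a \<in> divisibility_set G (c i0) (D i0 j0) \<inter> solvable_set G (R - {i0}) J' c D"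
      by simp
  qed
  moreover have "a \<in> solvable_set G R J c D"
    if dv: "a \<in> divisibility_set G (c i0) (D i0 j0)" and sol: "a \<in> solvable_set G (R - {i0}) J' c D" for a
  proof -
    obtain b where a: "a \<in> carrier G" and b: "b \<in> carrier G" "a [^] c i0 = b [^] D i0 j0"
      using dv unfolding divisibility_set_def int_multiples_def by blast
    obtain y where y: "y \<in> J' \<rightarrow> carrier G"
      and eq: "\<And>i. i \<in> R \<Longrightarrow> i \<noteq> i0 \<Longrightarrow> a [^] c i = (\<Otimes>j\<in>J'. y j [^] D i j)"
      using sol unfolding solvable_set_def by blast
    define z where "z = y(j0 := b)"
    have z: "z \<in> J \<rightarrow> carrier G" using y b J' by (auto simp: z_def Pi_iff)
    have "(\<Otimes>j\<in>J'. z j [^] D i j) = (\<Otimes>j\<in>J'. y j [^] D i j)" for i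
      using y J' by (intro finprod_cong') (auto simp: z_def Pi_iff)
    then have "a [^] c i = (\<Otimes>j\<in>J. z j [^] D i j)" if "i \<in> R" for i
      using that eq[of i] b(2) i0_eq[OF z] i_eq[OF z, of i] by (cases "i = i0") (auto simp: z_def)
    then show ?thesis using a z by (auto simp: solvable_set_def)
  qed
  ultimately show ?thesis unfolding J'_def by blast
qed

text \<open>Row and column operations reduce the absolute value of a pivot until it divides its row and
  its column; it can then be split off.\<close>

lemma solvable_set_separation:
  assumes "finite J" "a \<in> carrier G" "a \<notin> solvable_set G R J c D"
  shows "\<exists>c' e. solvable_set G R J c D \<subseteq> divisibility_set G c' e \<and> a \<notin> divisibility_set G c' e"
  using assms
proof (induction "card J" arbitrary: R J c D rule: less_induct)
  case outer: less
  show ?case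
  proof (cases "\<exists>i\<in>R. \<exists>j\<in>J. D i j \<noteq> 0")
    case False
    then have "(\<Otimes>j\<in>J. y j [^] D i j) = \<one>" if "i \<in> R" for i y
      using that by (intro finprod_one_eqI) simp
    then have *: "b \<in> solvable_set G R J c D \<longleftrightarrow> b \<in> carrier G \<and> (\<forall>i\<in>R. b [^] c i = \<one>)" for b
      by (auto simp: solvable_set_def intro!: bexI[of _ "\<lambda>_. \<one>"])
    then obtain i where i: "i \<in> R" "a [^] c i \<noteq> \<one>" using outer.prems by auto
    then show ?thesis
      \<comment> \<open>The equation \<open>c i\<close> times \<open>a\<close> equals 0 is the
        divisibility condition with \<open>e = 0\<close>.\<close>
      using * by (intro exI[of _ "c i"] exI[of _ 0]) (auto simp: divisibility_set_def int_multiples_def)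
  next
    case True
    then obtain i0 j0 where "i0 \<in> R" "j0 \<in> J" "D i0 j0 \<noteq> 0" by blast
    then show ?thesis using outer.prems(3)
    \<comment> \<open>The outer induction counts unknowns; the inner one follows the size of a
      nonzero pivot, whose position may move while the system is transformed.\<close>
    proof (induction "nat \<bar>D i0 j0\<bar>" arbitrary: i0 j0 c D rule: less_induct)
      case inner: less
      note i0 = \<open>i0 \<in> R\<close> and j0 = \<open>j0 \<in> J\<close> and nz = \<open>D i0 j0 \<noteq> 0\<close>
      have small: "nat \<bar>x mod D i0 j0\<bar> < nat \<bar>D i0 j0\<bar>" for x
        using nz by (simp add: abs_mod_less)
      consider (row) i where "i \<in> R" "\<not> D i0 j0 dvd D i j0"
        | (col) j where "j \<in> J" "\<not> D i0 j0 dvd D i0 j"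
        | (clear) "\<forall>i\<in>R. D i0 j0 dvd D i j0" "\<forall>j\<in>J. D i0 j0 dvd D i0 j"
        by blast
      then show ?case
      proof cases
        case row
        define t where "t = (\<lambda>_. 0)(i := - (D i j0 div D i0 j0))"
        have "i \<noteq> i0" using row by auto
        then have t: "t i0 = 0" by (simp add: t_def)
        have "D i j0 + t i * D i0 j0 = D i j0 mod D i0 j0"
          by (simp add: t_def minus_div_mult_eq_mod)
        then show ?thesis
          using inner.hyps[of "\<lambda>i j. D i j + t i * D i0 j" i j0 "\<lambda>i. c i + t i * c i0"] row j0
            small[of "D i j0"] inner.prems(4) solvable_set_row_op[of i0 R t J c D, OF i0 t]
          by (simp add: mod_eq_0_iff_dvd)
      next
        case col
        define t where "t = (\<lambda>_. 0)(j := - (D i0 j div D i0 j0))"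
        have "j \<noteq> j0" using col by auto
        then have t: "t j0 = 0" by (simp add: t_def)
        have "D i0 j + t j * D i0 j0 = D i0 j mod D i0 j0"
          by (simp add: t_def minus_div_mult_eq_mod)
        then show ?thesis
          using inner.hyps[of "\<lambda>i j. D i j + t j * D i j0" i0 j c] col i0
            small[of "D i0 j"] inner.prems(4) solvable_set_col_op[of J j0 t R c D, OF outer.prems(1) j0 t]
          by (simp add: mod_eq_0_iff_dvd)
      next
        case clear
        define t where "t = (\<lambda>i. if i = i0 then 0 else - (D i j0 div D i0 j0))"
        define s where "s = (\<lambda>j. if j = j0 then 0 else - (D i0 j div D i0 j0))"
        define c1 where "c1 = (\<lambda>i. c i + t i * c i0)"
        define D1 where "D1 = (\<lambda>i j. D i j + t i * D i0 j)"
        \<comment> \<open>Column \<open>j0\<close> of \<open>D1\<close> already vanishes off row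
          \<open>i0\<close>, so these column operations change only row \<open>i0\<close> and do not
          spoil the cleared column.\<close>
        define D2 where "D2 = (\<lambda>i j. D1 i j + s j * D1 i j0)"
        have eq: "solvable_set G R J c1 D2 = solvable_set G R J c D"
          using solvable_set_row_op[of i0 R t J c D, OF i0]
            solvable_set_col_op[of J j0 s R c1 D1, OF outer.prems(1) j0]
          by (simp add: D2_def c1_def D1_def t_def s_def)
        have D1_col: "D1 i j0 = 0" if "i \<in> R" "i \<noteq> i0" for i
          using that clear by (simp add: D1_def t_def)
        have D1_row: "D1 i0 j = D i0 j" for j by (simp add: D1_def t_def)
        have "solvable_set G R J c1 D2 = divisibility_set G (c1 i0) (D2 i0 j0) \<inter>
            solvable_set G (R - {i0}) (J - {j0}) c1 D2"
          using clear D1_col by (intro solvable_set_pivot outer.prems(1) j0 i0)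
            (auto simp: D2_def D1_row s_def)
        moreover have "card (J - {j0}) < card J" "finite (J - {j0})"
          using card_Diff1_less[OF outer.prems(1) j0] outer.prems(1) by auto
        ultimately show ?thesis
          using inner.prems(4) outer.hyps[of "J - {j0}" "R - {i0}" c1 D2] outer.prems(2) eq by blast
      qed
    qed
  qed
qed

text \<open>This says pointwise that a p.p. subgroup is an intersection of groups
  \<open>divisibility_set G c e\<close>. In this form no family of pairs \<open>(c, e)\<close> has
  to be carried through the inductions, and later refinements of the family simply compose.\<close>

lemma PP_separation:
  assumes "X \<in> PP G" "a \<in> carrier G" "a \<notin> X"
  shows "\<exists>c e. X \<subseteq> divisibility_set G c e \<and> a \<notin> divisibility_set G c e"
proof -
  obtain C D where X: "X = {a \<in> carrier G. pp_holds G C D (\<lambda>_. a)}" and C: "dim_col C = 1"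
    using assms(1) unfolding PP_def by blast
  have "mat_row_act G C (\<lambda>_. b) i = b [^] C $$ (i, 0)" if "b \<in> carrier G" for b i
    using that by (simp add: mat_row_act_def C lessThan_Suc)
  then have "X = solvable_set G {..<dim_row C} {..<dim_col D} (\<lambda>i. C $$ (i, 0)) (\<lambda>i j. D $$ (i, j))"
    by (auto simp: X pp_holds_def solvable_set_def mat_row_act_def[of G D])
  then show ?thesis using solvable_set_separation[OF _ assms(2)] assms(3) by (metis finite_lessThan)
qed

end

section \<open>Prime power divisibility conditions\<close>

definition primary_set :: "('a, 'b) monoid_scheme \<Rightarrow> nat \<Rightarrow> nat \<Rightarrow> nat \<Rightarrow> 'a set" where
  "primary_set G p k l = divisibility_set G (int p ^ k) (int p ^ l)"

context comm_group
begin

section \<open>The subgroups eA\<close>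

lemma int_multiples_subset: "int_multiples G e \<subseteq> carrier G"
  by (auto simp: int_multiples_def)

lemma int_multiples_mult:
  assumes "x \<in> int_multiples G e" "y \<in> int_multiples G e"
  shows "x \<otimes> y \<in> int_multiples G e"
proof -
  obtain b c where "b \<in> carrier G" "c \<in> carrier G" "x = b [^] e" "y = c [^] e"
    using assms by (auto simp: int_multiples_def)
  then show ?thesis
    by (auto simp: int_multiples_def int_pow_distrib intro!: image_eqI[of _ _ "b \<otimes> c"])
qed

lemma pow_in_int_multiples:
  assumes "x \<in> int_multiples G e" "e' dvd e * n"
  shows "x [^] n \<in> int_multiples G e'"
proof -
  obtain b where b: "b \<in> carrier G" "x = b [^] e" using assms by (auto simp: int_multiples_def)
  obtain q where "e * n = e' * q" using assms by auto
  then have "x [^] n = (b [^] q) [^] e'" using b by (simp add: int_pow_pow mult.commute)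
  then show ?thesis using b by (auto simp: int_multiples_def)
qed

lemma int_multiples_one: "int_multiples G 1 = carrier G"
  by (auto simp: int_multiples_def intro: image_eqI)

lemma pow_in_int_multiples_dvd:
  assumes "x \<in> carrier G" "e dvd n"
  shows "x [^] n \<in> int_multiples G e"
  using pow_in_int_multiples[of x 1 e n] assms by (simp add: int_multiples_one)

text \<open>If \<open>u * e + v * f = 1\<close>, then x = vf x + ue x. The first summand lies in efA
  because x is in eA, the second because x is in fA.\<close>

lemma int_multiples_bezout:
  assumes "coprime e f" "x \<in> int_multiples G e" "x \<in> int_multiples G f"
  shows "x \<in> int_multiples G (e * f)"
proof -
  obtain u v where uv: "u * e + v * f = 1" using assms(1) bezout_int[of e f] by auto
  have x: "x \<in> carrier G" using assms(2) int_multiples_subset by blast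
  have "x = x [^] (v * f) \<otimes> x [^] (u * e)"
    using x uv by (simp add: int_pow_mult[symmetric] add.commute)
  moreover have "x [^] (v * f) \<in> int_multiples G (e * f)" "x [^] (u * e) \<in> int_multiples G (e * f)"
    using assms(2,3) by (auto intro: pow_in_int_multiples)
  ultimately show ?thesis using int_multiples_mult by metis
qed

lemma int_multiples_prime_powers:
  assumes "n > 0" "\<And>p k. prime p \<Longrightarrow> p ^ k dvd n \<Longrightarrow> x \<in> int_multiples G (int p ^ k)"
  shows "x \<in> int_multiples G (int n)"
  using assms
proof (induction n rule: less_induct)
  case (less n)
  show ?case
  proof (cases "n = 1")
    case True
    \<comment> \<open>The empty prime power \<open>2 ^ 0\<close> divides 1, so the hypothesis
      applies to it.\<close>
    then show ?thesis using less.prems(2)[of 2 0] by simp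
  next
    case False
    then obtain p where p: "prime p" "p dvd n" using prime_factor_nat by blast
    then obtain q where q: "n = p ^ multiplicity p n * q" "\<not> p dvd q"
      using less.prems(1) multiplicity_decompose'[of n p]
      by (metis not_gr0 not_prime_unit)
    have mp: "multiplicity p n > 0" using p less.prems(1) by (simp add: prime_multiplicity_gt_zero_iff)
    have "1 < p ^ multiplicity p n" using p(1) mp by (intro one_less_power prime_gt_1_nat)
    moreover have q0: "q > 0" using q(2) by (cases "q = 0") auto
    ultimately have "q < p ^ multiplicity p n * q" by simp
    then have "q < n" using q(1) by simp
    moreover have "q dvd n" using q(1) by (rule dvdI[OF trans[OF _ mult.commute]])
    ultimately have "x \<in> int_multiples G (int q)"
      using less.IH[of q] q0 less.prems(2) dvd_trans by blast
    moreover have "x \<in> int_multiples G (int p ^ multiplicity p n)"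
      using less.prems(2) p by (simp add: multiplicity_dvd)
    moreover have "coprime (int p ^ multiplicity p n) (int q)"
      using p q(2) by (simp add: prime_imp_coprime)
    ultimately have "x \<in> int_multiples G (int p ^ multiplicity p n * int q)"
      using int_multiples_bezout by blast
    then show ?thesis using q(1) by (metis of_nat_mult of_nat_power)
  qed
qed

section \<open>The groups B(p,k,l) and the reduction to prime powers\<close>

lemma primary_set_iff:
  "a \<in> primary_set G p k l \<longleftrightarrow> a \<in> carrier G \<and> a [^] (int p ^ k) \<in> int_multiples G (int p ^ l)"
  by (simp add: primary_set_def divisibility_set_def)

text \<open>Multiplying by p^(k'-k) raises both exponents by k'-k, and the second one may then be
  lowered freely. The second hypothesis is l - k >= l' - k', written without truncated
  subtraction.\<close>

lemma primary_set_mono: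
  assumes "k \<le> k'" "l' + k \<le> l + k'"
  shows "primary_set G p k l \<subseteq> primary_set G p k' l'"
proof
  fix a assume a: "a \<in> primary_set G p k l"
  have "int p ^ l' dvd int p ^ l * int p ^ (k' - k)"
    using assms by (simp add: power_add[symmetric] le_imp_power_dvd)
  then have "(a [^] (int p ^ k)) [^] (int p ^ (k' - k)) \<in> int_multiples G (int p ^ l')"
    using a pow_in_int_multiples[of "a [^] (int p ^ k)" "int p ^ l" "int p ^ l'"]
    by (simp add: primary_set_iff)
  then show "a \<in> primary_set G p k' l'"
    using a assms by (simp add: primary_set_iff int_pow_pow power_add[symmetric])
qed

lemma primary_set_trivial:
  assumes "l \<le> k"
  shows "primary_set G p k l = carrier G"
  using assms by (auto simp: primary_set_iff pow_in_int_multiples_dvd le_imp_power_dvd)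

lemma primary_set_in_PP: "primary_set G p k l \<in> PP G"
proof -
  define C D where "C = mat 1 1 (\<lambda>_. int p ^ k)" and "D = mat 1 1 (\<lambda>_. int p ^ l)"
  have "mat_row_act G C y 0 = y 0 [^] (int p ^ k)" "mat_row_act G D y 0 = y 0 [^] (int p ^ l)"
    if "y 0 \<in> carrier G" for y
    using that by (simp_all add: mat_row_act_def C_def D_def lessThan_Suc)
  then have "pp_holds G C D (\<lambda>_. a) \<longleftrightarrow> (\<exists>y\<in>{..<Suc 0} \<rightarrow> carrier G. a [^] (int p ^ k) = y 0 [^] (int p ^ l))"
    if "a \<in> carrier G" for a
    using that unfolding pp_holds_def by (auto simp: C_def D_def Pi_iff)
  moreover have "(\<exists>y\<in>{..<Suc 0} \<rightarrow> carrier G. z = y 0 [^] (int p ^ l)) \<longleftrightarrow>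
      z \<in> int_multiples G (int p ^ l)" for z
  proof
    assume "z \<in> int_multiples G (int p ^ l)"
    then obtain b where "b \<in> carrier G" "z = b [^] (int p ^ l)" by (auto simp: int_multiples_def)
    then show "\<exists>y\<in>{..<Suc 0} \<rightarrow> carrier G. z = y 0 [^] (int p ^ l)"
      by (intro bexI[of _ "\<lambda>_. b"]) auto
  qed (auto simp: int_multiples_def Pi_iff)
  ultimately have "primary_set G p k l = {a \<in> carrier G. pp_holds G C D (\<lambda>_. a)}"
    by (auto simp: primary_set_iff)
  then show ?thesis unfolding PP_def
    by (intro CollectI exI[of _ C] exI[of _ D]) (simp add: C_def D_def)
qed

text \<open>The factor \<open>c\<close> is invertible modulo p^l: from uc + vp^l = 1 follows p^k a =
  u(p^k c a) + p^l(v p^k a), and both summands lie in p^l A.\<close>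

lemma divisibility_set_subset_primary_set:
  assumes p: "prime p" "\<not> int p dvd c" and l: "int p ^ l dvd e"
  shows "divisibility_set G (int p ^ k * c) e \<subseteq> primary_set G p k l"
proof
  fix a assume "a \<in> divisibility_set G (int p ^ k * c) e"
  then have a: "a \<in> carrier G" "a [^] (int p ^ k * c) \<in> int_multiples G e"
    by (auto simp: divisibility_set_def)
  have "coprime c (int p ^ l)"
    using p by (metis coprime_commute coprime_power_left_iff prime_imp_coprime prime_int_nat_transfer of_nat_0_le_iff nat_int)
  then obtain u v where uv: "u * c + v * int p ^ l = 1" using bezout_int[of c "int p ^ l"] by auto
  have "int p ^ k * c * u + int p ^ k * v * int p ^ l = int p ^ k * (u * c + v * int p ^ l)"
    by (simp add: algebra_simps)
  then have "a [^] (int p ^ k) = a [^] (int p ^ k * c * u + int p ^ k * v * int p ^ l)"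
    using uv by simp
  also have "\<dots> = (a [^] (int p ^ k * c)) [^] u \<otimes> a [^] (int p ^ k * v * int p ^ l)"
    using a by (simp add: int_pow_mult int_pow_pow)
  also have "\<dots> \<in> int_multiples G (int p ^ l)"
    using a l by (intro int_multiples_mult pow_in_int_multiples[OF a(2)] pow_in_int_multiples_dvd) auto
  finally show "a \<in> primary_set G p k l" using a by (simp add: primary_set_iff)
qed

lemma int_multiples_abs: "int_multiples G \<bar>e\<bar> = int_multiples G e"
proof -
  have "x [^] \<bar>e\<bar> \<in> int_multiples G e" "x [^] e \<in> int_multiples G \<bar>e\<bar>" if "x \<in> carrier G" for x
    using that by (auto intro: pow_in_int_multiples_dvd)
  then show ?thesis by (auto simp: int_multiples_def[of G "\<bar>e\<bar>"] int_multiples_def[of G e])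
qed

text \<open>If ca is not in eA, then it already misses p^l A for some prime power p^l dividing e.
  The part of c prime to p can then be discarded, which turns c into a power of p.\<close>

lemma divisibility_set_separation:
  assumes m: "m > 0" "\<forall>a\<in>carrier G. a [^] (m::nat) = \<one>"
    and a: "a \<in> carrier G" "a \<notin> divisibility_set G c e"
  shows "\<exists>p k l. prime p \<and> divisibility_set G c e \<subseteq> primary_set G p k l \<and> a \<notin> primary_set G p k l"
proof -
  \<comment> \<open>A positive number is needed for the factorisation. For \<open>e = 0\<close> the
    exponent \<open>m\<close> can stand in, since mA and 0A are both trivial.\<close>
  define n where "n = (if e = 0 then m else nat \<bar>e\<bar>)"
  have n: "n > 0" using m by (simp add: n_def)
  have "int_multiples G (int m) = {\<one>}"
    using m by (auto simp: int_multiples_def int_pow_int)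
  moreover have "int_multiples G 0 = {\<one>}"
    by (auto simp: int_multiples_def)
  ultimately have ne: "int_multiples G (int n) = int_multiples G e"
    by (simp add: n_def int_multiples_abs)
  then have dn: "divisibility_set G c e = divisibility_set G c (int n)"
    by (simp add: divisibility_set_def)
  then have "a [^] c \<notin> int_multiples G (int n)" using a by (simp add: divisibility_set_def)
  then obtain p l where p: "prime p" "p ^ l dvd n" "a [^] c \<notin> int_multiples G (int p ^ l)"
    using int_multiples_prime_powers[OF n] by blast
  have "c \<noteq> 0" using p(3) a pow_in_int_multiples_dvd[of a "int p ^ l" 0] by auto
  moreover have "\<not> is_unit (int p)" using p(1) by (auto simp: prime_nat_iff)
  ultimately obtain k c' where c: "c = int p ^ k * c'" "\<not> int p dvd c'"
    using multiplicity_decompose'[of c "int p"] by metis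
  have "int p ^ l dvd int n" using p(2) by (metis of_nat_dvd_iff of_nat_power)
  then have "divisibility_set G c e \<subseteq> primary_set G p k l"
    using divisibility_set_subset_primary_set[OF p(1) c(2), of l "int n" k] dn c(1) by simp
  moreover have "a \<notin> primary_set G p k l"
    using p(3) a(1) pow_in_int_multiples[of "a [^] (int p ^ k)" "int p ^ l" "int p ^ l" c']
    by (auto simp: primary_set_iff c(1) int_pow_pow)
  ultimately show ?thesis using p(1) by blast
qed

section \<open>Ulm invariants and their effect on the groups B(p,k,l)\<close>

lemma int_multiples_of_nat: "int_multiples G (int n) = multiples G n"
  by (simp add: int_multiples_def multiples_def int_pow_int)

text \<open>With K and H the two torsion subgroups, the quotient consists of the cosets of H by
  elements of K, so it is trivial iff K lies in H. As p annihilates K, this only asks that K lie in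
  p^(i+1) A.\<close>

lemma ulm_eq_1_iff:
  "ulm p i G = 1 \<longleftrightarrow>
    torsion_in G p (multiples G (p ^ i)) \<subseteq> multiples G (p ^ (i + 1))"
proof -
  define K where "K = torsion_in G p (multiples G (p ^ i))"
  define H where "H = torsion_in G p (multiples G (p ^ (i + 1)))"
  define Q where "Q = (\<lambda>a. H #> a) ` K"
  have Q: "carrier (G\<lparr>carrier := K\<rparr> Mod H) = Q"
    by (auto simp: FactGroup_def RCOSETS_def r_coset_def Q_def)
  have Kc: "K \<subseteq> carrier G" by (auto simp: K_def torsion_in_def multiples_def)
  have Hc: "H \<subseteq> carrier G" by (auto simp: H_def torsion_in_def multiples_def)
  have oneH: "\<one> \<in> H" "\<one> \<in> K"
    unfolding H_def K_def torsion_in_def multiples_def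
    by (auto intro!: image_eqI[of _ _ \<one>])
  have mult: "x \<otimes> y \<in> H" if "x \<in> H" "y \<in> H" for x y
    using that by (auto simp: H_def torsion_in_def int_multiples_of_nat[symmetric] multiples_def[symmetric]
        nat_pow_distrib int_multiples_mult subsetD[OF int_multiples_subset])
  have inv: "inv x \<in> H" if "x \<in> H" for x
  proof -
    have "x \<in> carrier G" using that Hc by auto
    then have "inv x = x [^] (-1::int)" by (simp add: int_pow_neg)
    then have "inv x \<in> multiples G (p ^ (i + 1))"
      using that pow_in_int_multiples[of x "int (p ^ (i + 1))" "int (p ^ (i + 1))" "-1"]
      unfolding H_def torsion_in_def int_multiples_of_nat by auto
    then show ?thesis
      using that \<open>x \<in> carrier G\<close> by (auto simp: H_def torsion_in_def nat_pow_inv)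
  qed
  have "subgroup H G"
    using Hc oneH mult inv by (intro subgroup.intro) auto
  then have coset: "H #> x = H \<longleftrightarrow> x \<in> H" if "x \<in> carrier G" for x
    using that rcos_self coset_join2 by metis
  \<comment> \<open>For infinite \<open>Q\<close> both sides are false: the invariant is infinite,
    while \<open>card Q\<close> is 0.\<close>
  have "ulm p i G = 1 \<longleftrightarrow> card Q = 1"
    by (auto simp: ulm_def Q K_def[symmetric] H_def[symmetric, simplified] one_enat_def card_eq_0_iff)
  also have "\<dots> \<longleftrightarrow> Q = {H}"
  proof -
    have "H \<in> Q" using oneH coset[of \<one>] by (auto simp: Q_def intro!: image_eqI[of _ _ \<one>])
    then show ?thesis by (auto simp: card_1_singleton_iff)
  qed
  also have "\<dots> \<longleftrightarrow> K \<subseteq> H"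
    using coset Kc oneH by (auto simp: Q_def image_iff)
  also have "\<dots> \<longleftrightarrow> K \<subseteq> multiples G (p ^ (i + 1))"
    by (auto simp: K_def H_def torsion_in_def)
  finally show ?thesis unfolding K_def .
qed

lemma not_in_ulm_set_iff:
  "i \<notin> ulm_set p G \<longleftrightarrow>
    (\<forall>z \<in> int_multiples G (int p ^ i). z [^] int p = \<one> \<longrightarrow> z \<in> int_multiples G (int p ^ (i + 1)))"
  unfolding ulm_set_def mem_Collect_eq ulm_eq_1_iff not_not torsion_in_def
    int_multiples_of_nat[symmetric] of_nat_power int_pow_int by blast

text \<open>Let p^(k+1) a = p^(i+2) c and w = p^(i+1) c. Then z = p^k a - w lies in p^i A and is
  annihilated by p, so it lies in p^(i+1) A because the invariant at i is trivial. Hence p^k a = z +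
  w does too.\<close>

lemma primary_set_inter:
  assumes "i \<notin> ulm_set p G" "a \<in> primary_set G p k i" "a \<in> primary_set G p (k + 1) (i + 2)"
  shows "a \<in> primary_set G p k (i + 1)"
proof -
  have a: "a \<in> carrier G" using assms by (simp add: primary_set_iff)
  obtain c where c: "c \<in> carrier G" "a [^] (int p ^ (k + 1)) = c [^] (int p ^ (i + 2))"
    using assms(3) by (auto simp: primary_set_iff int_multiples_def)
  define w where "w = c [^] (int p ^ (i + 1))"
  define z where "z = a [^] (int p ^ k) \<otimes> w [^] (-1::int)"
  have w: "w \<in> carrier G" "w \<in> int_multiples G (int p ^ (i + 1))"
    using c by (auto simp: w_def int_multiples_def)
  have "z \<in> int_multiples G (int p ^ i)"
    unfolding z_def using assms(2) w
    by (intro int_multiples_mult pow_in_int_multiples[OF w(2)]) (auto simp: primary_set_iff)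
  moreover have "z [^] int p = \<one>"
  proof -
    have "z [^] int p = a [^] (int p ^ (k + 1)) \<otimes> inv (c [^] (int p ^ (i + 2)))"
      using a w c by (simp add: z_def w_def int_pow_distrib int_pow_pow int_pow_neg[symmetric] mult.commute)
    then show ?thesis using c by simp
  qed
  ultimately have "z \<in> int_multiples G (int p ^ (i + 1))"
    using assms(1) not_in_ulm_set_iff by blast
  then have "z \<otimes> w \<in> int_multiples G (int p ^ (i + 1))"
    using w int_multiples_mult by blast
  moreover have "z \<otimes> w = a [^] (int p ^ k)"
    using a w by (simp add: z_def int_pow_neg m_assoc)
  ultimately show ?thesis using a by (simp add: primary_set_iff)
qed

text \<open>The gcd of p^l and m is a power p^j with j < p^j <= m <= k, so it divides p^k. By Bezout
  p^k is a multiple of p^l plus a multiple of m, and the latter annihilates A.\<close>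

lemma primary_set_stable:
  assumes p: "prime p" and m: "m > 0" "\<forall>a\<in>carrier G. a [^] (m::nat) = \<one>" and k: "m \<le> k"
  shows "primary_set G p k l = carrier G"
proof -
  obtain j where j: "gcd (p ^ l) m = p ^ j"
    using p by (metis divides_primepow_nat gcd_dvd1)
  have "j < p ^ j" using p by (intro power_gt_expt) (simp add: prime_gt_Suc_0_nat)
  also have "p ^ j \<le> m" using j m(1) by (metis dvd_imp_le gcd_dvd2)
  finally have "gcd (p ^ l) m dvd p ^ k" using j k by (simp add: le_imp_power_dvd)
  then have "gcd (int p ^ l) (int m) dvd int p ^ k"
    by (metis gcd_int_int_eq of_nat_dvd_iff of_nat_power)
  then obtain q where q: "int p ^ k = gcd (int p ^ l) (int m) * q" by blast
  obtain u v where "u * int p ^ l + v * int m = gcd (int p ^ l) (int m)"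
    using bezout_int by blast
  then have uv: "int p ^ k = int p ^ l * (u * q) + int m * (v * q)"
    unfolding q by (metis (no_types) distrib_right mult.assoc mult.commute)
  have "a \<in> primary_set G p k l" if a: "a \<in> carrier G" for a
  proof -
    have "a [^] (int m * (v * q)) = \<one>"
      using a m(2) by (simp add: int_pow_pow[symmetric] int_pow_int)
    then have "a [^] (int p ^ k) = a [^] (int p ^ l * (u * q))"
      using a by (simp add: uv int_pow_mult)
    then show ?thesis using a pow_in_int_multiples_dvd by (simp add: primary_set_iff)
  qed
  then show ?thesis by (auto simp: primary_set_iff)
qed

text \<open>Induction on \<open>r\<close>, and downwards on \<open>k\<close> for fixed \<open>r\<close>: \<open>primary_set_inter\<close> either
  lowers \<open>r\<close> or keeps \<open>r\<close> and raises \<open>k\<close>.\<close>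

lemma primary_set_separation:
  assumes p: "prime p" and m: "m > 0" "\<forall>a\<in>carrier G. a [^] (m::nat) = \<one>"
    and a: "a \<in> carrier G" "a \<notin> primary_set G p k (k + r)"
  shows "\<exists>k' i. i \<in> ulm_set p G \<and> k' \<le> i \<and>
    primary_set G p k (k + r) \<subseteq> primary_set G p k' (i + 1) \<and> a \<notin> primary_set G p k' (i + 1)"
  using a(2)
proof (induction r arbitrary: k)
  case 0
  then show ?case using a primary_set_trivial by simp
next
  case (Suc r)
  note IH = Suc.IH
  have "k \<le> m" using Suc.prems primary_set_stable[OF p m] a(1) nat_le_linear by blast
  then show ?case using Suc.prems
  \<comment> \<open>The downward induction starts at \<open>k = m\<close>, where the group is all of
    A and no point lies outside.\<close>
  proof (induction rule: inc_induct)
    case base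
    then show ?case using primary_set_stable[OF p m, of m] a(1) by blast
  next
    case (step k)
    show ?case
    proof (cases "k + r \<in> ulm_set p G")
      case True
      then show ?thesis
        using step.prems by (intro exI[of _ k] exI[of _ "k + r"]) auto
    next
      case False
      have "primary_set G p k (k + Suc r) \<subseteq> primary_set G p k (k + r)"
        "primary_set G p k (k + Suc r) \<subseteq> primary_set G p (Suc k) (Suc k + Suc r)"
        by (rule primary_set_mono; simp)+
      moreover have "a \<notin> primary_set G p k (k + r) \<or> a \<notin> primary_set G p (Suc k) (Suc k + Suc r)"
        using primary_set_inter[OF False] step.prems by auto
      ultimately show ?thesis using IH[of k] step.IH by (meson subset_trans)
    qed
  qed
qed

lemma PP_separation_primary:
  assumes m: "m > 0" "\<forall>a\<in>carrier G. a [^] (m::nat) = \<one>"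
    and "X \<in> PP G" and a: "a \<in> carrier G" "a \<notin> X"
  shows "\<exists>p i k. prime p \<and> i \<in> ulm_set p G \<and> k \<le> i \<and>
    X \<subseteq> primary_set G p k (i + 1) \<and> a \<notin> primary_set G p k (i + 1)"
proof -
  obtain c e where "X \<subseteq> divisibility_set G c e" "a \<notin> divisibility_set G c e"
    using PP_separation assms by blast
  moreover obtain p k l where p: "prime p" and
    "divisibility_set G c e \<subseteq> primary_set G p k l" and nl: "a \<notin> primary_set G p k l"
    using divisibility_set_separation[OF m a(1) \<open>a \<notin> divisibility_set G c e\<close>] by blast
  moreover have "k < l" using nl primary_set_trivial a(1) not_le by blast
  then obtain r where "l = k + r" using less_imp_add_positive by blast
  ultimately show ?thesis
    using primary_set_separation[OF p m a(1), of k r] by (meson subset_trans)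
qed

text \<open>Choose g such that p^i g is annihilated by p but not in p^(i+1) A, and put a = p^(i-k)
  g. Then p^k a = p^i g, while p^(k+1) a = 0, so multiples by higher powers of p vanish. The fourth
  property holds because p^k' a = p^(i-k+k') g, the last because a p-torsion element is divisible by
  every power of another prime.\<close>

lemma primary_set_witness:
  assumes p: "prime p" and i: "i \<in> ulm_set p G" and k: "k \<le> i"
  obtains a where "a \<in> carrier G" "a \<notin> primary_set G p k (i + 1)"
    "\<And>k' l. k < k' \<Longrightarrow> a \<in> primary_set G p k' l"
    "\<And>k' l. l + k \<le> k' + i \<Longrightarrow> a \<in> primary_set G p k' l"
    "\<And>q k' l. prime q \<Longrightarrow> q \<noteq> p \<Longrightarrow> a \<in> primary_set G q k' l"
proof -
  obtain z where z: "z \<in> int_multiples G (int p ^ i)" "z [^] int p = \<one>"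
    "z \<notin> int_multiples G (int p ^ (i + 1))"
    using i not_in_ulm_set_iff by blast
  then obtain g where "g \<in> carrier G" "z = g [^] (int p ^ i)"
    unfolding int_multiples_def[of G "int p ^ i"] by blast
  with z have g: "g \<in> carrier G" "(g [^] (int p ^ i)) [^] int p = \<one>"
    "g [^] (int p ^ i) \<notin> int_multiples G (int p ^ (i + 1))" by blast+
  define a where "a = g [^] (int p ^ (i - k))"
  have a: "a \<in> carrier G" using g by (simp add: a_def)
  have pow: "a [^] (int p ^ k') = g [^] (int p ^ (i - k + k'))" for k'
    using g by (simp add: a_def int_pow_pow power_add)
  have triv: "a [^] (int p ^ k') = \<one>" if "k < k'" for k'
  proof -
    obtain t where "k' = k + 1 + t" using \<open>k < k'\<close> less_imp_Suc_add by fastforce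
    then have e: "i - k + k' = Suc i + t" using k by simp
    have "a [^] (int p ^ k') = g [^] (int p ^ i * int p * int p ^ t)"
      unfolding pow e by (simp only: power_add power_Suc2)
    also have "\<dots> = ((g [^] (int p ^ i)) [^] int p) [^] (int p ^ t)"
      using g(1) by (simp only: int_pow_pow int_pow_closed)
    finally have "a [^] (int p ^ k') = ((g [^] (int p ^ i)) [^] int p) [^] (int p ^ t)" .
    then show ?thesis using g by simp
  qed
  show thesis
  proof (rule that[of a])
    show "a \<in> carrier G" by fact
    show "a \<notin> primary_set G p k (i + 1)"
      using g k by (simp add: primary_set_iff pow)
    show "a \<in> primary_set G p k' l" if "k < k'" for k' l
      using triv[OF that] a pow_in_int_multiples_dvd[of \<one> "int p ^ l" 0] by (simp add: primary_set_iff)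
    show "a \<in> primary_set G p k' l" if "l + k \<le> k' + i" for k' l
      using that k a g by (simp add: primary_set_iff pow pow_in_int_multiples_dvd le_imp_power_dvd)
    show "a \<in> primary_set G q k' l" if q: "prime q" "q \<noteq> p" for q k' l
    proof -
      have "coprime (int p) (int q)" using primes_coprime[OF p q(1)] q(2) by simp
      then have "coprime (int p ^ (k + 1)) (int q ^ l)"
        by (intro coprime_power_left_iff[THEN iffD2] coprime_power_right_iff[THEN iffD2]) simp
      then obtain u v where uv: "u * int p ^ (k + 1) + v * int q ^ l = 1"
        using bezout_int[of "int p ^ (k + 1)" "int q ^ l"] by auto
      have "a = a [^] (int p ^ (k + 1) * u + int q ^ l * v)"
        using uv a by (simp add: mult.commute)
      also have "\<dots> = (a [^] (int p ^ (k + 1))) [^] u \<otimes> a [^] (int q ^ l * v)"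
        using a by (simp add: int_pow_mult int_pow_pow)
      also have "\<dots> = a [^] (int q ^ l * v)"
        using triv[of "k + 1"] a by simp
      finally have "a \<in> int_multiples G (int q ^ l)"
        using a pow_in_int_multiples_dvd by (metis dvd_triv_left)
      then show ?thesis
        using a pow_in_int_multiples[of a "int q ^ l" "int q ^ l" "int q ^ k'"]
        by (simp add: primary_set_iff)
    qed
  qed
qed

end

section \<open>Gap numbers\<close>

text \<open>Polymorphic because \<open>ulm_set\<close> consists of naturals while
  \<open>gap_number\<close> takes a set of integers.\<close>

definition separated :: "'a::{linorder,semiring_1} set \<Rightarrow> bool" where
  "separated S \<longleftrightarrow> (\<forall>x\<in>S. \<forall>y\<in>S. x < y \<longrightarrow> x + 2 \<le> y)"

lemma separated_int_image: "separated (int ` S) \<longleftrightarrow> separated S"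
proof -
  have "int x + 2 \<le> int y \<longleftrightarrow> x + 2 \<le> y" for x y by linarith
  then show ?thesis by (simp add: separated_def)
qed

lemma nth_elem_less:
  assumes "finite I" "1 \<le> a" "a < b" "b \<le> card I"
  shows "nth_elem I a < nth_elem I b"
  using assms sorted_wrt_nth_less[OF strict_sorted_list_of_set, of "a - 1" "b - 1" I]
  by (simp add: nth_elem_def)

lemma nth_elem_le:
  assumes "finite I" "1 \<le> a" "a \<le> b" "b \<le> card I"
  shows "nth_elem I a \<le> nth_elem I b"
  using nth_elem_less[of I a b] assms by (cases "a = b") auto

lemma nth_elem_in:
  assumes "finite I" "1 \<le> a" "a \<le> card I"
  shows "nth_elem I a \<in> I"
proof -
  have "sorted_list_of_set I ! (a - 1) \<in> set (sorted_list_of_set I)"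
    using assms by (intro nth_mem) simp
  then show ?thesis using assms by (simp add: nth_elem_def)
qed

lemma nth_elem_surj:
  assumes "finite I" "x \<in> I"
  obtains a where "1 \<le> a" "a \<le> card I" "x = nth_elem I a"
proof -
  obtain q where "q < card I" "x = sorted_list_of_set I ! q"
    using assms by (metis in_set_conv_nth length_sorted_list_of_set set_sorted_list_of_set)
  then show thesis using that[of "Suc q"] by (simp add: nth_elem_def)
qed

text \<open>Each step of the sequence raises the element by at least 2: it either crosses one gap
  larger than 1 or passes two strict increases. The elements visited thus form the separated
  subset.\<close>

lemma gap_sequence_imp_separated:
  assumes I: "finite I" and gap: "gap_sequence I d j"
  shows "\<exists>S\<subseteq>I. separated S \<and> card S = d"
proof -
  define e where "e = (\<lambda>k. nth_elem I (j k))"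
  have j1: "j 1 = 1" and d: "d \<ge> 1" and mono: "strict_mono_on {1..d} j" and jd: "j d \<le> card I"
    and step: "\<And>k. k \<in> {1..<d} \<Longrightarrow> j (k + 1) - j k =
        (if nth_elem I (j k + 1) - nth_elem I (j k) > 1 then 1 else 2)"
    using gap by (auto simp: gap_sequence_def)
  have j_range: "1 \<le> j k" "j k \<le> card I" if "k \<in> {1..d}" for k
    using strict_mono_on_leD[OF mono, of 1 k] strict_mono_on_leD[OF mono, of k d] that d j1 jd
    by auto
  have e_step: "e k + 2 \<le> e (k + 1)" if k: "k \<in> {1..<d}" for k
  proof -
    have jk: "1 \<le> j k" "j (k + 1) \<le> card I" using j_range[of k] j_range[of "k + 1"] k by auto
    show ?thesis
    proof (cases "nth_elem I (j k + 1) - nth_elem I (j k) > 1")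
      case True
      then have "j (k + 1) = j k + 1" using step[OF k] by simp
      then show ?thesis using True by (simp add: e_def)
    next
      case False
      then have eq: "j (k + 1) = j k + 2" using step[OF k] by simp
      then have "nth_elem I (j k) < nth_elem I (j k + 1)" "nth_elem I (j k + 1) < nth_elem I (j k + 2)"
        using jk I by (auto intro!: nth_elem_less)
      then show ?thesis unfolding e_def eq by linarith
    qed
  qed
  have e_less: "e s + 2 \<le> e t" if "1 \<le> s" "s < t" "t \<le> d" for s t
    using that(2,1,3)
  proof (induction rule: less_Suc_induct)
    case (1 i)
    then show ?case using e_step[of i] by simp
  next
    case (2 i j k)
    then show ?case by simp
  qed
  have inj: "inj_on e {1..d}"
    by (rule linorder_inj_onI) (use e_less in fastforce)+
  have "separated (e ` {1..d})"
    unfolding separated_def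
  proof (intro ballI impI)
    fix x y assume "x \<in> e ` {1..d}" "y \<in> e ` {1..d}" "x < y"
    then obtain s t where st: "s \<in> {1..d}" "t \<in> {1..d}" "x = e s" "y = e t" by blast
    then have "s < t" using \<open>x < y\<close> e_less[of t s] by (cases s t rule: linorder_cases) auto
    then show "x + 2 \<le> y" using st e_less by auto
  qed
  moreover have "e ` {1..d} \<subseteq> I"
    using nth_elem_in[OF I] j_range by (auto simp: e_def)
  ultimately show ?thesis using card_image[OF inj] by auto
qed

text \<open>The greedy sequence stays ahead of every separated subset.\<close>

lemma separated_imp_gap_sequence:
  assumes I: "finite I" and S: "S \<subseteq> I" "separated S" "S \<noteq> {}"
  shows "\<exists>j. gap_sequence I (card S) j"
proof -
  have fS: "finite S" using I S finite_subset by blast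
  define f where "f = (\<lambda>a. a + (if nth_elem I (a + 1) - nth_elem I a > 1 then 1 else 2 :: nat))"
  \<comment> \<open>Indices count from 1, so \<open>j 1 = 1\<close> is the zeroth iterate of the
    greedy step \<open>f\<close>.\<close>
  define j where "j = (\<lambda>k. (f ^^ (k - 1)) 1)"
  have j_Suc: "j (k + 1) = f (j k)" if "k \<ge> 1" for k
    using that by (cases k) (auto simp: j_def)
  have ahead: "1 \<le> j k \<and> j k \<le> card I \<and> nth_elem I (j k) \<le> nth_elem S k"
    if "1 \<le> k" "k \<le> card S" for k
    using that
  proof (induction k rule: nat_induct_at_least)
    case base
    then have "nth_elem S 1 \<in> I" using nth_elem_in[OF fS, of 1] S by auto
    then obtain q where "1 \<le> q" "q \<le> card I" "nth_elem S 1 = nth_elem I q"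
      using nth_elem_surj[OF I] by blast
    then show ?case using nth_elem_le[OF I, of 1 q] by (simp add: j_def)
  next
    case (Suc k)
    then have IH: "1 \<le> j k" "j k \<le> card I" "nth_elem I (j k) \<le> nth_elem S k" by auto
    have "nth_elem S k \<in> S" "nth_elem S (Suc k) \<in> S"
      using nth_elem_in[OF fS] Suc by auto
    moreover have "nth_elem S k < nth_elem S (Suc k)"
      using nth_elem_less[OF fS] Suc by auto
    ultimately have gap: "nth_elem S k + 2 \<le> nth_elem S (Suc k)" and "nth_elem S (Suc k) \<in> I"
      using S unfolding separated_def by auto
    then obtain q where q: "1 \<le> q" "q \<le> card I" "nth_elem S (Suc k) = nth_elem I q"
      using nth_elem_surj[OF I] by blast
    have jq: "j k < q"
      using nth_elem_le[OF I, of q "j k"] q IH gap by (cases "j k < q") auto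
    \<comment> \<open>Overshooting \<open>q\<close> would require a jump by 2 with
      \<open>q = j k + 1\<close>. The jump by 2 means that the next element of \<open>I\<close> is
      at most 1 larger, whereas the one at \<open>q\<close> is at least 2 larger.\<close>
    have "f (j k) \<le> q"
    proof (cases "nth_elem I (j k + 1) - nth_elem I (j k) > 1")
      case True
      then show ?thesis using jq by (simp add: f_def)
    next
      case False
      then have "q \<noteq> j k + 1" using gap q IH by auto
      then show ?thesis using False jq by (simp add: f_def)
    qed
    moreover have "1 \<le> f (j k)" using IH by (simp add: f_def)
    ultimately show ?case
      using j_Suc[of k] Suc.hyps q nth_elem_le[OF I, of "f (j k)" q] by auto
  qed
  have f: "a < f a" for a by (simp add: f_def)
  have "j s < j t" if "1 \<le> s" "s < t" for s t
    using that(2,1)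
  proof (induction rule: less_Suc_induct)
    case (1 i)
    then show ?case using j_Suc[of i] f by simp
  next
    case (2 i j k)
    then show ?case by simp
  qed
  then have "strict_mono_on {1..card S} j" by (auto intro!: strict_mono_onI)
  moreover have "card S \<ge> 1" using S fS by (simp add: card_gt_0_iff Suc_leI)
  moreover have "j (k + 1) - j k = (if nth_elem I (j k + 1) - nth_elem I (j k) > 1 then 1 else 2)"
    if "k \<in> {1..<card S}" for k
    using that j_Suc[of k] by (simp add: f_def)
  ultimately have "gap_sequence I (card S) j"
    unfolding gap_sequence_def using ahead[of "card S"] by (auto simp: j_def)
  then show ?thesis by blast
qed

text \<open>This makes the \<open>Max\<close> in \<open>gap_number\<close> a genuine
  maximum.\<close>

lemma finite_gap_lengths:
  assumes "finite I"
  shows "finite {d. \<exists>j. gap_sequence I d j}"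
proof -
  have "d \<le> card I" if "gap_sequence I d j" for d j
    using gap_sequence_imp_separated[OF assms that] card_mono[OF assms] by blast
  then show ?thesis by (intro finite_subset[OF _ finite_atMost[of "card I"]]) auto
qed

lemma separated_card_le_gap_number:
  assumes "finite U" "S \<subseteq> U" "separated S"
  shows "card S \<le> gap_number (int ` U)"
proof (cases "S = {}")
  case False
  have "\<exists>j. gap_sequence (int ` U) (card (int ` S)) j"
    using assms False by (intro separated_imp_gap_sequence) (auto simp: separated_int_image)
  then show ?thesis
    using False assms finite_gap_lengths[of "int ` U"]
    by (auto simp: gap_number_def card_image intro!: Max_ge)
qed simp

lemma separated_attains_gap_number:
  assumes "finite U"
  shows "\<exists>S\<subseteq>U. separated S \<and> card S = gap_number (int ` U)"
proof (cases "U = {}")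
  case True
  then show ?thesis by (auto simp: gap_number_def separated_def)
next
  case False
  then obtain u where "u \<in> U" by blast
  then have "{d. \<exists>j. gap_sequence (int ` U) d j} \<noteq> {}"
    using separated_imp_gap_sequence[of "int ` U" "{int u}"] assms by (auto simp: separated_def)
  then have "\<exists>j. gap_sequence (int ` U) (gap_number (int ` U)) j"
    using Max_in[OF finite_gap_lengths[of "int ` U"]] assms False by (simp add: gap_number_def)
  then obtain T where T: "T \<subseteq> int ` U" "separated T" "card T = gap_number (int ` U)"
    using gap_sequence_imp_separated[of "int ` U"] assms by blast
  then obtain S where "S \<subseteq> U" "T = int ` S" by (meson subset_imageE)
  then show ?thesis using T by (auto simp: separated_int_image card_image)
qed

section \<open>Breadth\<close>

text \<open>The definition of breadth asks for exactly \<open>d\<close> indices; a smaller set of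
  indices is padded by repeating \<open>b\<close>.\<close>

lemma exists_covering_index:
  fixes d :: nat
  assumes "finite T" "card T \<le> d" "T \<subseteq> B" "b \<in> B"
  shows "\<exists>i\<in>{1..d} \<rightarrow> B. T \<subseteq> i ` {1..d}"
proof -
  obtain h where h: "bij_betw h {1..card T} T" using ex_bij_betw_nat_finite_1[OF assms(1)] by blast
  define i where "i = (\<lambda>k. if k \<le> card T then h k else b)"
  have "i \<in> {1..d} \<rightarrow> B" using h assms by (auto simp: i_def Pi_iff bij_betw_def)
  moreover have "T \<subseteq> i ` {1..d}"
  proof
    fix t assume "t \<in> T"
    then obtain k where "k \<in> {1..card T}" "t = h k"
      using bij_betw_imp_surj_on[OF h] by blast
    then show "t \<in> i ` {1..d}" using assms(2) by (intro image_eqI[of _ _ k]) (auto simp: i_def)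
  qed
  ultimately show ?thesis by blast
qed

definition gap_total :: "('a, 'b) monoid_scheme \<Rightarrow> nat" where
  "gap_total G = (\<Sum>p | prime p \<and> ulm_set p G \<noteq> {}. gap_number (int ` ulm_set p G))"

text \<open>A triple (p, i, k) stands for the group B(p,k,i+1); \<open>i\<close> precedes
  \<open>k\<close> because the range of \<open>k\<close> depends on it.\<close>

definition primary_index :: "('a, 'b) monoid_scheme \<Rightarrow> (nat \<times> nat \<times> nat) set" where
  "primary_index G = (SIGMA p:{p. prime p \<and> ulm_set p G \<noteq> {}}. SIGMA i:ulm_set p G. {..i})"

definition primary_member :: "('a, 'b) monoid_scheme \<Rightarrow> nat \<times> nat \<times> nat \<Rightarrow> 'a set" where
  "primary_member G = (\<lambda>(p, i, k). primary_set G p k (i + 1))"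

context comm_group
begin

text \<open>Split \<open>E\<close> by primes. For one prime, incomparability of (i,k) and (i',k')
  excludes k = k', and k < k' forces i' - i > k' - k >= 1. So i determines the triple, and the
  values of i form a separated subset of \<open>ulm_set p G\<close>.\<close>

lemma primary_antichain_card:
  assumes fin: "finite_exponent G"
    and E: "E \<subseteq> primary_index G"
    and anti: "\<And>z w. z \<in> E \<Longrightarrow> w \<in> E \<Longrightarrow> z \<noteq> w \<Longrightarrow> \<not> primary_member G z \<subseteq> primary_member G w"
  shows "card E \<le> gap_total G"
proof -
  define P where "P = {p. prime p \<and> ulm_set p G \<noteq> {}}"
  have P: "finite P" and U: "\<And>p. p \<in> P \<Longrightarrow> finite (ulm_set p G)"
    using finite_ulm_support[OF comm_group_axioms fin] by (auto simp: P_def)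
  define E' where "E' = (\<lambda>p. {z \<in> E. fst z = p})"
  have "card (E' p) \<le> gap_number (int ` ulm_set p G)" if p: "p \<in> P" for p
  proof -
    have apart: "i + 2 \<le> i' \<or> i' + 2 \<le> i"
      if zw: "(p, i, k) \<in> E" "(p, i', k') \<in> E" "(i, k) \<noteq> (i', k')" for i k i' k'
    proof -
      have "\<not> (k \<le> k' \<and> i' + 1 + k \<le> i + 1 + k')" "\<not> (k' \<le> k \<and> i + 1 + k' \<le> i' + 1 + k)"
        using anti[OF zw(1,2)] anti[OF zw(2,1)] zw(3)
          primary_set_mono[of k k' "i' + 1" "i + 1" p] primary_set_mono[of k' k "i + 1" "i' + 1" p]
        by (auto simp: primary_member_def)
      then show ?thesis by linarith
    qed
    define g where "g = (\<lambda>z :: nat \<times> nat \<times> nat. fst (snd z))"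
    have mem: "\<exists>i k. z = (p, i, k) \<and> (p, i, k) \<in> E" if "z \<in> E' p" for z
      using that by (cases z) (auto simp: E'_def)
    have inj: "inj_on g (E' p)"
    proof (rule inj_onI)
      fix z w assume zw: "z \<in> E' p" "w \<in> E' p" "g z = g w"
      then obtain i k i' k' where "z = (p, i, k)" "(p, i, k) \<in> E" "w = (p, i', k')" "(p, i', k') \<in> E"
        using mem by meson
      then show "z = w" using apart[of i k i' k'] zw(3) by (auto simp: g_def)
    qed
    have "separated (g ` E' p)"
      unfolding separated_def
    proof (intro ballI impI)
      fix x y assume xy: "x \<in> g ` E' p" "y \<in> g ` E' p" "x < y"
      then obtain k k' where "(p, x, k) \<in> E" "(p, y, k') \<in> E"
        using mem by (fastforce simp: g_def)
      then show "x + 2 \<le> y" using apart[of x k y k'] xy(3) by auto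
    qed
    moreover have "g ` E' p \<subseteq> ulm_set p G"
      using E mem by (force simp: g_def primary_index_def)
    ultimately show ?thesis
      using separated_card_le_gap_number[OF U[OF p]] card_image[OF inj] by metis
  qed
  then have "(\<Sum>p\<in>P. card (E' p)) \<le> (\<Sum>p\<in>P. gap_number (int ` ulm_set p G))"
    by (rule sum_mono)
  moreover have "E = (\<Union>p\<in>P. E' p)"
    using E by (auto simp: E'_def P_def primary_index_def)
  then have "card E \<le> (\<Sum>p\<in>P. card (E' p))"
    using card_UN_le[OF P] by metis
  ultimately show ?thesis by (simp add: gap_total_def P_def)
qed

lemma finite_primary_index:
  assumes "finite_exponent G"
  shows "finite (primary_index G)"
  using finite_ulm_support[OF comm_group_axioms assms]
  by (auto simp: primary_index_def intro!: finite_SigmaI)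

text \<open>The upper bound. Among the indexed groups lying above some \<open>x t\<close>, take a
  smallest set \<open>E\<close> that still cuts out the intersection. Minimality makes it an
  antichain, hence it has at most \<open>gap_total G\<close> members, and one \<open>x t\<close>
  below each of them suffices.\<close>

lemma PP_inter_subfamily:
  fixes n :: nat
  assumes fin: "finite_exponent G"
    and n: "n > gap_total G"
    and x: "x \<in> {1..n} \<rightarrow> PP G"
  shows "\<exists>i\<in>{1..gap_total G} \<rightarrow> {1..n}.
    carrier G \<inter> \<Inter>(x ` {1..n}) = carrier G \<inter> \<Inter>((\<lambda>k. x (i k)) ` {1..gap_total G})"
proof -
  obtain m :: nat where m: "m > 0" "\<forall>a\<in>carrier G. a [^] m = \<one>"
    using fin unfolding finite_exponent_def by blast
  define Z where "Z = carrier G \<inter> \<Inter>(x ` {1..n})"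
  define F where "F = {z \<in> primary_index G. \<exists>t\<in>{1..n}. x t \<subseteq> primary_member G z}"
  define good where "good = (\<lambda>E. E \<subseteq> F \<and> carrier G \<inter> \<Inter>(primary_member G ` E) \<subseteq> Z)"
  have F: "finite F" using finite_primary_index[OF fin] by (simp add: F_def)
  \<comment> \<open>By separation, a point outside some \<open>x t\<close> is also outside an
    indexed group containing \<open>x t\<close>, which belongs to \<open>F\<close>.\<close>
  have "good F"
    unfolding good_def
  proof (intro conjI subset_refl subsetI, rule ccontr)
    fix a assume a: "a \<in> carrier G \<inter> \<Inter>(primary_member G ` F)" "a \<notin> Z"
    then obtain t where t: "t \<in> {1..n}" "a \<notin> x t" by (auto simp: Z_def)
    then have "x t \<in> PP G" using x by auto
    then obtain p i k where "prime p" "i \<in> ulm_set p G" "k \<le> i"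
      "x t \<subseteq> primary_set G p k (i + 1)" and na: "a \<notin> primary_set G p k (i + 1)"
      using PP_separation_primary[OF m _ _ t(2)] a by blast
    then have "(p, i, k) \<in> F" using t(1)
      by (auto simp: F_def primary_index_def primary_member_def intro!: bexI[of _ t])
    then show False using a(1) na by (force simp: primary_member_def)
  qed
  then obtain E where E: "good E" and least: "\<And>E'. good E' \<Longrightarrow> card E \<le> card E'"
    using ex_has_least_nat[of good F card] by blast
  have fE: "finite E" using E F finite_subset by (auto simp: good_def)
  have "card E \<le> gap_total G"
  proof (rule primary_antichain_card[OF fin])
    show "E \<subseteq> primary_index G" using E by (auto simp: good_def F_def)
    fix z w assume zw: "z \<in> E" "w \<in> E" "z \<noteq> w"
    show "\<not> primary_member G z \<subseteq> primary_member G w"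
    proof
      assume sub: "primary_member G z \<subseteq> primary_member G w"
      have "\<Inter>(primary_member G ` (E - {w})) \<subseteq> \<Inter>(primary_member G ` E)"
        using zw sub by blast
      then have "good (E - {w})" using E by (auto simp: good_def)
      then show False using least card_Diff1_less[OF fE zw(2)] by fastforce
    qed
  qed
  have "\<forall>z\<in>E. \<exists>t\<in>{1..n}. x t \<subseteq> primary_member G z" using E by (auto simp: good_def F_def)
  then obtain \<tau> where \<tau>: "\<And>z. z \<in> E \<Longrightarrow> \<tau> z \<in> {1..n} \<and> x (\<tau> z) \<subseteq> primary_member G z"
    by metis
  have "card (\<tau> ` E) \<le> gap_total G" using \<open>card E \<le> gap_total G\<close> card_image_le[OF fE] le_trans by blast
  moreover have "\<tau> ` E \<subseteq> {1..n}" "n \<in> {1..n}" using \<tau> n by auto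
  ultimately obtain i where i: "i \<in> {1..gap_total G} \<rightarrow> {1..n}" and cover: "\<tau> ` E \<subseteq> i ` {1..gap_total G}"
    using exists_covering_index[of "\<tau> ` E" "gap_total G" "{1..n}" n] fE by auto
  have "carrier G \<inter> \<Inter>((\<lambda>k. x (i k)) ` {1..gap_total G}) \<subseteq> carrier G \<inter> \<Inter>(primary_member G ` E)"
  proof
    fix a assume a: "a \<in> carrier G \<inter> \<Inter>((\<lambda>k. x (i k)) ` {1..gap_total G})"
    have "a \<in> primary_member G z" if z: "z \<in> E" for z
    proof -
      obtain k where "k \<in> {1..gap_total G}" "\<tau> z = i k" using cover z by blast
      then show ?thesis using a \<tau>[OF z] by auto
    qed
    then show "a \<in> carrier G \<inter> \<Inter>(primary_member G ` E)" using a by blast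
  qed
  also have "\<dots> \<subseteq> Z" using E by (simp add: good_def)
  finally have "carrier G \<inter> \<Inter>((\<lambda>k. x (i k)) ` {1..gap_total G}) \<subseteq> Z" .
  moreover have "Z \<subseteq> carrier G \<inter> \<Inter>((\<lambda>k. x (i k)) ` {1..gap_total G})"
    using i unfolding Z_def by blast
  ultimately show ?thesis using i unfolding Z_def by blast
qed

text \<open>The lower bound. For each prime a separated subset of maximal size supplies one group
  per element, and \<open>primary_set_witness\<close> yields a point that misses exactly one of
  these groups.\<close>

lemma PP_irredundant_family:
  assumes fin: "finite_exponent G"
  shows "\<exists>x\<in>{1..gap_total G} \<rightarrow> PP G.
    \<forall>t\<in>{1..gap_total G}.
      \<exists>a\<in>carrier G. a \<notin> x t \<and>
        (\<forall>s\<in>{1..gap_total G} - {t}. a \<in> x s)"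
proof -
  define P where "P = {p. prime p \<and> ulm_set p G \<noteq> {}}"
  have P: "finite P" and U: "\<And>p. p \<in> P \<Longrightarrow> finite (ulm_set p G)"
    using finite_ulm_support[OF comm_group_axioms fin] by (auto simp: P_def)
  have "\<forall>p\<in>P. \<exists>S\<subseteq>ulm_set p G. separated S \<and> card S = gap_number (int ` ulm_set p G)"
    using separated_attains_gap_number U by blast
  then obtain S where S: "\<And>p. p \<in> P \<Longrightarrow> S p \<subseteq> ulm_set p G \<and> separated (S p) \<and>
      card (S p) = gap_number (int ` ulm_set p G)"
    by metis
  have fS: "finite (S p)" if "p \<in> P" for p using S[OF that] U[OF that] finite_subset by blast
  have "card (Sigma P S) = gap_total G" using P fS S by (simp add: gap_total_def P_def[symmetric])
  moreover have "finite (Sigma P S)" using P fS by auto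
  ultimately obtain h where h: "bij_betw h {1..gap_total G} (Sigma P S)"
    using ex_bij_betw_nat_finite_1 by metis
  \<comment> \<open>With k = i div 2, both k and i - k grow by at least 1 whenever i grows by at
    least 2. This is what the witness for i needs: larger j fall under its vanishing multiples,
    smaller j under its divisibility.\<close>
  define V where "V = (\<lambda>(p, i). primary_set G p (i div 2) (i + 1))"
  have witness: "\<exists>a\<in>carrier G. a \<notin> V z \<and> (\<forall>w\<in>Sigma P S - {z}. a \<in> V w)" if z: "z \<in> Sigma P S" for z
  proof -
    obtain p i where pi: "z = (p, i)" "p \<in> P" "i \<in> S p" using z by blast
    then have p: "prime p" and i: "i \<in> ulm_set p G" using S by (auto simp: P_def)
    obtain a where a: "a \<in> carrier G" "a \<notin> primary_set G p (i div 2) (i + 1)"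
      and a1: "\<And>k' l. i div 2 < k' \<Longrightarrow> a \<in> primary_set G p k' l"
      and a2: "\<And>k' l. l + i div 2 \<le> k' + i \<Longrightarrow> a \<in> primary_set G p k' l"
      and a3: "\<And>q k' l. prime q \<Longrightarrow> q \<noteq> p \<Longrightarrow> a \<in> primary_set G q k' l"
      using primary_set_witness[OF p i div_le_dividend] by blast
    have "a \<in> V w" if w: "w \<in> Sigma P S - {z}" for w
    proof -
      obtain q j where qj: "w = (q, j)" "q \<in> P" "j \<in> S q" using w by blast
      show ?thesis
      proof (cases "q = p")
        case False
        then show ?thesis using a3[of q] qj by (simp add: V_def P_def)
      next
        case True
        then have "j + 2 \<le> i \<or> i + 2 \<le> j"
          using w pi qj S[OF pi(2)] unfolding separated_def by (metis Diff_iff insertCI linorder_neqE_nat)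
        then have "i div 2 < j div 2 \<or> (j + 1) + i div 2 \<le> j div 2 + i" by linarith
        then show ?thesis using a1 a2 True qj by (auto simp: V_def)
      qed
    qed
    then show ?thesis using a pi by (auto simp: V_def)
  qed
  show ?thesis
  proof (intro bexI[of _ "V \<circ> h"] ballI)
    show "V \<circ> h \<in> {1..gap_total G} \<rightarrow> PP G"
      using primary_set_in_PP by (auto simp: V_def Pi_iff split: prod.splits)
    fix t assume t: "t \<in> {1..gap_total G}"
    then have ht: "h t \<in> Sigma P S" using bij_betwE[OF h] by blast
    obtain a where a: "a \<in> carrier G" "a \<notin> V (h t)" "\<forall>w\<in>Sigma P S - {h t}. a \<in> V w"
      using witness[OF ht] by blast
    moreover have "h s \<in> Sigma P S - {h t}" if s: "s \<in> {1..gap_total G} - {t}" for s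
      using s t bij_betwE[OF h] inj_onD[OF bij_betw_imp_inj_on[OF h], of s t] by blast
    ultimately show "\<exists>a\<in>carrier G. a \<notin> (V \<circ> h) t \<and> (\<forall>s\<in>{1..gap_total G} - {t}. a \<in> (V \<circ> h) s)"
      by (intro bexI[of _ a]) auto
  qed
qed

end

theorem theorem5p1:
  fixes A :: "('a, 'b) monoid_scheme"
  assumes "comm_group A" and "finite_exponent A"
  shows "breadth (PP_lattice A) =
         enat (\<Sum>p | prime p \<and> ulm_set p A \<noteq> {}. gap_number (int ` ulm_set p A))"
proof -
  interpret comm_group A by fact
  define d where "d = gap_total A"
  define bounds where "bounds = {d :: nat. \<forall>n>d. \<forall>x\<in>{1..n} \<rightarrow> carrier (PP_lattice A). \<exists>i\<in>{1..d} \<rightarrow> {1..n}.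
     \<Sqinter>\<^bsub>PP_lattice A\<^esub>(x ` {1..n}) = \<Sqinter>\<^bsub>PP_lattice A\<^esub>((\<lambda>k. x (i k)) ` {1..d})}"
  have carrier: "carrier (PP_lattice A) = PP A" by (simp add: PP_lattice_def)
  \<comment> \<open>Intersecting with the carrier also gives the correct value for the empty meet,
    which occurs when the bound is 0.\<close>
  have inf: "\<Sqinter>\<^bsub>PP_lattice A\<^esub>(x ` K) = carrier A \<inter> \<Inter>(x ` K)"
    if "finite K" "x \<in> K \<rightarrow> PP A" for x and K :: "nat set"
    using that by (intro inf_PP_lattice) auto
  have "d \<in> bounds"
    unfolding bounds_def mem_Collect_eq carrier
  proof (intro allI impI ballI)
    fix n x assume n: "d < n" and x: "x \<in> {1..n} \<rightarrow> PP A"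
    obtain i where i: "i \<in> {1..d} \<rightarrow> {1..n}" and
      eq: "carrier A \<inter> \<Inter>(x ` {1..n}) = carrier A \<inter> \<Inter>((\<lambda>k. x (i k)) ` {1..d})"
      using PP_inter_subfamily[OF assms(2) n[unfolded d_def] x] unfolding d_def by blast
    have "(\<lambda>k. x (i k)) \<in> {1..d} \<rightarrow> PP A" using i x by (auto simp: Pi_iff)
    then show "\<exists>i\<in>{1..d} \<rightarrow> {1..n}. \<Sqinter>\<^bsub>PP_lattice A\<^esub>(x ` {1..n}) =
        \<Sqinter>\<^bsub>PP_lattice A\<^esub>((\<lambda>k. x (i k)) ` {1..d})"
      using i eq inf[OF _ x] inf[of "{1..d}" "\<lambda>k. x (i k)"] by (intro bexI[of _ i]) simp_all
  qed
  moreover have "d \<le> d'" if d': "d' \<in> bounds" for d'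
  proof (rule ccontr)
    assume "\<not> d \<le> d'"
    then have less: "d' < d" by simp
    obtain x where x: "x \<in> {1..d} \<rightarrow> PP A" and
      irr: "\<And>t. t \<in> {1..d} \<Longrightarrow> \<exists>a\<in>carrier A. a \<notin> x t \<and> (\<forall>s\<in>{1..d} - {t}. a \<in> x s)"
      using PP_irredundant_family[OF assms(2)] unfolding d_def by blast
    obtain i where i: "i \<in> {1..d'} \<rightarrow> {1..d}" and
      eq: "\<Sqinter>\<^bsub>PP_lattice A\<^esub>(x ` {1..d}) = \<Sqinter>\<^bsub>PP_lattice A\<^esub>((\<lambda>k. x (i k)) ` {1..d'})"
      using d' less x unfolding bounds_def mem_Collect_eq carrier by blast
    have "(\<lambda>k. x (i k)) \<in> {1..d'} \<rightarrow> PP A" using i x by (auto simp: Pi_iff)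
    then have eq': "carrier A \<inter> \<Inter>(x ` {1..d}) = carrier A \<inter> \<Inter>((\<lambda>k. x (i k)) ` {1..d'})"
      using eq inf[OF _ x] inf[of "{1..d'}" "\<lambda>k. x (i k)"] by simp
    \<comment> \<open>Fewer than \<open>d\<close> indices omit some \<open>t\<close>; the point
      missing only \<open>x t\<close> then lies in the chosen meet but not in the full one.\<close>
    have "card (i ` {1..d'}) < card {1..d}"
      using card_image_le[of "{1..d'}" i] less by simp
    then obtain t where t: "t \<in> {1..d}" "t \<notin> i ` {1..d'}"
      by (metis card_mono finite_atLeastAtMost finite_imageI not_le subsetI)
    then obtain a where a: "a \<in> carrier A" "a \<notin> x t" "\<forall>s\<in>{1..d} - {t}. a \<in> x s"
      using irr by blast
    have "a \<in> x (i k)" if "k \<in> {1..d'}" for k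
      using a(3) i t(2) that by (metis DiffI PiE imageI singletonD)
    then show False using eq' a t by blast
  qed
  ultimately have "Inf {enat d | d. d \<in> bounds} = enat d"
    by (intro antisym Inf_lower Inf_greatest) auto
  then show ?thesis unfolding breadth_def d_def gap_total_def bounds_def mem_Collect_eq .
qed

end
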